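(* Let $G$ be an infinite finitely generated group acting by isometries on proper CAT(0) spaces $X_1$ and $X_2$ such that the orbit maps $G\to X_1$ and $G\to X_2$ are quasi-isometric embeddings. Then there exist a proper CAT(0) space $X$ and an action of $G$ on $X$ by isometries such that the orbit map $G\to X$ is a quasi-isometric embedding and such that, for $i=1,2$, there is a limset map $\operatorname{limset}(X,G)\to\operatorname{limset}(X_i,G)\subseteq\partial X_i$. Moreover, if the actions of $G$ on both $X_1$ and $X_2$ are by semi-simple isometries, then the action on $X$ can be taken (for the same $X$) to be by semi-simple isometries as well.
   Context: $G$ carries the word metric of a finite generating set. A map $f:(A,d)\to(B,d')$ is a quasi-isometric embedding (QIE) if there are constants $\lambda,\varepsilon>0$ with $\frac1\lambda d(a,a')-\varepsilon\le d'(f(a),f(a'))\le\lambda d(a,a')+\varepsilon$ for all $a,a'$. The orbit map is $g\mapsto gx_0$ for a base point $x_0$ (the QIE property does not depend on $x_0$); if it is a QIE into a proper space, the action is properly discontinuous. An isometry $g$ of $X$ is semi-simple if $\inf_{x}d(x,gx)$ is attained. For a proper CAT(0) space $X$, $\partial X$ is the visual boundary with the cone topology and $\overline X=X\cup\partial X$ the corresponding compactification. If $G$ acts properly discontinuously by isometries on $X$ with base point $x_0$, then $\operatorname{limset}(X,G)=\overline{Gx_0}\cap\partial X$ (closure in $\overline X$; independent of $x_0$). The set $G\cup\operatorname{limset}(X,G)$ is a compactification of the discrete space $G$, with basis of open sets the singletons $\{g\}$, $g\in G$, and the sets $\{g\in G: gx_0\in U\}\cup(U\cap\operatorname{limset}(X,G))$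 for $U$ open in $\overline X$. If $G$ acts in this way on $X$ and on $Y$, a limset map $\operatorname{limset}(X,G)\to\operatorname{limset}(Y,G)$ is the restriction of a continuous map $G\cup\operatorname{limset}(X,G)\to G\cup\operatorname{limset}(Y,G)$ extending the identity of $G$ (and taking $\operatorname{limset}(X,G)$ into $\operatorname{limset}(Y,G)$). *)

theory Defs
  imports
    "HOL-Analysis.Analysis"
    "HOL-Algebra.Generated_Groups"
    "HOL-Algebra.Group_Action"
begin

section \<open>Word metrics and quasi-isometric embeddings\<close>

definition word_length :: "('g, 'm) monoid_scheme \<Rightarrow> 'g set \<Rightarrow> 'g \<Rightarrow> nat" where
  "word_length G S g =
     (LEAST n. \<exists>ws. length ws = n \<and> set ws \<subseteq> S \<union> m_inv G ` S \<and> foldr (mult G) ws (one G) = g)"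

text \<open>The left-invariant word metric, which is the one matching orbit maps of left actions.\<close>

definition word_dist :: "('g, 'm) monoid_scheme \<Rightarrow> 'g set \<Rightarrow> 'g \<Rightarrow> 'g \<Rightarrow> real" where
  "word_dist G S g h = real (word_length G S (inv\<^bsub>G\<^esub> g \<otimes>\<^bsub>G\<^esub> h))"

definition quasi_isometric_embedding ::
  "'a set \<Rightarrow> ('a \<Rightarrow> 'a \<Rightarrow> real) \<Rightarrow> 'b set \<Rightarrow> ('b \<Rightarrow> 'b \<Rightarrow> real) \<Rightarrow> ('a \<Rightarrow> 'b) \<Rightarrow> bool" where
  "quasi_isometric_embedding A d B d' f \<longleftrightarrow>
     f \<in> A \<rightarrow> B \<and>
     (\<exists>L>0. \<exists>\<epsilon>>0. \<forall>a\<in>A. \<forall>a'\<in>A.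
        1 / L * d a a' - \<epsilon> \<le> d' (f a) (f a') \<and> d' (f a) (f a') \<le> L * d a a' + \<epsilon>)"


section \<open>Proper CAT(0) spaces\<close>

definition (in Metric_space) geodesic :: "'a \<Rightarrow> 'a \<Rightarrow> (real \<Rightarrow> 'a) \<Rightarrow> bool" where
  "geodesic x y c \<longleftrightarrow>
     c \<in> {0..d x y} \<rightarrow> M \<and> c 0 = x \<and> c (d x y) = y \<and>
     (\<forall>s\<in>{0..d x y}. \<forall>t\<in>{0..d x y}. d (c s) (c t) = \<bar>s - t\<bar>)"

text \<open>
  In the comparison axiom, two points of a geodesic triangle lie on two sides \<open>[p,q]\<close> and
  \<open>[p,r]\<close> issuing from a common vertex; the third side does not enter the inequality, and it
  always exists. The comparison triangle has the vertices \<open>p'\<close>, \<open>q'\<close>, \<open>r'\<close> in the Euclidean plane.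
\<close>

locale CAT0_space = Metric_space +
  assumes geodesic_exists: "\<And>x y. x \<in> M \<Longrightarrow> y \<in> M \<Longrightarrow> \<exists>c. geodesic x y c"
    and CAT0_comparison:
      "\<And>p q r c c' s t (p'::real^2) q' r' x' y'.
         \<lbrakk>p \<in> M; q \<in> M; r \<in> M; geodesic p q c; geodesic p r c';
          dist p' q' = d p q; dist p' r' = d p r; dist q' r' = d q r;
          s \<in> {0..d p q}; x' \<in> closed_segment p' q'; dist p' x' = s;
          t \<in> {0..d p r}; y' \<in> closed_segment p' r'; dist p' y' = t\<rbrakk>
         \<Longrightarrow> d (c s) (c' t) \<le> dist x' y'"

locale proper_CAT0_space = CAT0_space +
  assumes proper: "\<And>x r. x \<in> M \<Longrightarrow> compactin mtopology (mcball x r)"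


section \<open>Visual boundary and cone topology\<close>

context Metric_space
begin

definition geodesic_ray :: "(real \<Rightarrow> 'a) \<Rightarrow> bool" where
  "geodesic_ray c \<longleftrightarrow> c \<in> {0..} \<rightarrow> M \<and> (\<forall>s\<ge>0. \<forall>t\<ge>0. d (c s) (c t) = \<bar>s - t\<bar>)"

definition asymptotic :: "((real \<Rightarrow> 'a) \<times> (real \<Rightarrow> 'a)) set" where
  "asymptotic =
     {(c, c'). geodesic_ray c \<and> geodesic_ray c' \<and> (\<exists>K. \<forall>t\<ge>0. d (c t) (c' t) \<le> K)}"

definition visual_boundary :: "(real \<Rightarrow> 'a) set set" where
  "visual_boundary = Collect geodesic_ray // asymptotic"

text \<open>
  The compactification is the disjoint union of the space (tagged \<open>Inl\<close>) and its visual boundary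
  (tagged \<open>Inr\<close>). The following is the set \<open>U(c,r,\<epsilon>)\<close> of all its points \<open>z\<close> at distance more than
  \<open>r\<close> from \<open>c 0\<close> whose projection to the closed ball of radius \<open>r\<close> about \<open>c 0\<close> is \<open>\<epsilon>\<close>-close to
  \<open>c r\<close>. In a CAT(0) space, that projection is the point at distance \<open>r\<close> from \<open>c 0\<close> on the unique
  geodesic, or geodesic ray, from \<open>c 0\<close> to \<open>z\<close>.
\<close>

definition cone_nbhd :: "(real \<Rightarrow> 'a) \<Rightarrow> real \<Rightarrow> real \<Rightarrow> ('a + (real \<Rightarrow> 'a) set) set" where
  "cone_nbhd c r \<epsilon> =
     Inl ` {x \<in> M. d (c 0) x > r \<and> (\<exists>\<sigma>. geodesic (c 0) x \<sigma> \<and> d (\<sigma> r) (c r) < \<epsilon>)} \<union>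
     Inr ` {\<xi> \<in> visual_boundary. \<exists>\<rho>\<in>\<xi>. \<rho> 0 = c 0 \<and> d (\<rho> r) (c r) < \<epsilon>}"

text \<open>The resulting topology does not depend on the point \<open>b\<close> if the space is complete CAT(0).\<close>

definition cone_topology :: "'a \<Rightarrow> ('a + (real \<Rightarrow> 'a) set) topology" where
  "cone_topology b = topology_generated_by
     ({Inl ` mball x r |x r. x \<in> M \<and> r > 0} \<union>
      {cone_nbhd c r \<epsilon> |c r \<epsilon>. geodesic_ray c \<and> c 0 = b \<and> r > 0 \<and> \<epsilon> > 0})"

end


section \<open>Isometric actions and limit sets\<close>

locale isometric_action = group_action G M \<phi> + Metric_space M d
  for G :: "('g, 'm) monoid_scheme" (structure)
    and M :: "'a set" and d :: "'a \<Rightarrow> 'a \<Rightarrow> real" and \<phi> :: "'g \<Rightarrow> 'a \<Rightarrow> 'a" +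
  assumes isometry: "\<And>g x y. g \<in> carrier G \<Longrightarrow> x \<in> M \<Longrightarrow> y \<in> M \<Longrightarrow> d (\<phi> g x) (\<phi> g y) = d x y"

context Metric_space
begin

definition semi_simple :: "('a \<Rightarrow> 'a) \<Rightarrow> bool" where
  "semi_simple f \<longleftrightarrow> (\<exists>x\<in>M. d x (f x) = (INF y\<in>M. d y (f y)))"

definition limset ::
  "('g, 'm) monoid_scheme \<Rightarrow> ('g \<Rightarrow> 'a \<Rightarrow> 'a) \<Rightarrow> 'a \<Rightarrow> (real \<Rightarrow> 'a) set set" where
  "limset G \<phi> x\<^sub>0 =
     {\<xi> \<in> visual_boundary. Inr \<xi> \<in> cone_topology x\<^sub>0 closure_of (Inl ` orbit G \<phi> x\<^sub>0)}"

definition limset_compactification ::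
  "('g, 'm) monoid_scheme \<Rightarrow> ('g \<Rightarrow> 'a \<Rightarrow> 'a) \<Rightarrow> 'a \<Rightarrow> ('g + (real \<Rightarrow> 'a) set) topology" where
  "limset_compactification G \<phi> x\<^sub>0 = topology_generated_by
     ({{Inl g} |g. g \<in> carrier G} \<union>
      {Inl ` {g \<in> carrier G. Inl (\<phi> g x\<^sub>0) \<in> U} \<union> Inr ` {\<xi> \<in> limset G \<phi> x\<^sub>0. Inr \<xi> \<in> U} |U.
         openin (cone_topology x\<^sub>0) U})"

end

definition limset_map ::
  "('g, 'm) monoid_scheme \<Rightarrow>
   'a set \<Rightarrow> ('a \<Rightarrow> 'a \<Rightarrow> real) \<Rightarrow> ('g \<Rightarrow> 'a \<Rightarrow> 'a) \<Rightarrow> 'a \<Rightarrow>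
   'b set \<Rightarrow> ('b \<Rightarrow> 'b \<Rightarrow> real) \<Rightarrow> ('g \<Rightarrow> 'b \<Rightarrow> 'b) \<Rightarrow> 'b \<Rightarrow>
   ((real \<Rightarrow> 'a) set \<Rightarrow> (real \<Rightarrow> 'b) set) \<Rightarrow> bool" where
  "limset_map G X d \<phi> x\<^sub>0 Y e \<psi> y\<^sub>0 f \<longleftrightarrow>
     f \<in> Metric_space.limset X d G \<phi> x\<^sub>0 \<rightarrow> Metric_space.limset Y e G \<psi> y\<^sub>0 \<and>
     (\<exists>F. continuous_map (Metric_space.limset_compactification X d G \<phi> x\<^sub>0)
                         (Metric_space.limset_compactification Y e G \<psi> y\<^sub>0) F \<and>
          (\<forall>g\<in>carrier G. F (Inl g) = Inl g) \<and>
          (\<forall>\<xi>\<in>Metric_space.limset X d G \<phi> x\<^sub>0. F (Inr \<xi>) = Inr (f \<xi>)))"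

end

theory Submission
  imports Defs
begin

text \<open>
  Take \<open>X = X\<^sub>1 \<times> X\<^sub>2\<close> with the \<open>\<ell>\<^sup>2\<close>-metric and the diagonal action. A geodesic of \<open>X\<close> is a pair of
  geodesics of the factors, each traversed at constant speed. Since both orbit maps are
  quasi-isometric embeddings, the distances moved by \<open>g\<close> in \<open>X\<^sub>1\<close> and \<open>X\<^sub>2\<close> are comparable, so a ray
  towards a limit point of the orbit in \<open>X\<close> has positive speed in both factors. Reparametrising
  its components by arc length gives the limset maps; they are continuous because geodesics from
  a common point that are close far out are close before.
\<close>

section \<open>Geodesics and comparison\<close>

text \<open>The visual boundary of a product may contain directions that stand still in one factor,
  and projection assigns to them no boundary point of that factor. So the maps live on limit sets,
  and the orbit has to be kept away from such directions quantitatively. Projections scale distances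
  along a geodesic by a constant factor; hence a linear lower bound on the displacement of the base
  point by \<open>g\<close> is inherited, up to a bounded error, at every earlier radius
  \<open>R\<close> on the geodesic to that orbit point. This bound at a fixed radius is what
  survives the passage to a limit ray. For continuity, the obstacle is that the scale factor depends
  on the orbit point, so equal times in the product become different times in the factor. The
  projection of the point at radius \<open>R\<close> serves as the common reference: it lies on the
  factor geodesic to the orbit point and close to the projected limit ray.\<close>

context Metric_space
begin

lemma geodesic_in_space: "geodesic x y c \<Longrightarrow> 0 \<le> t \<Longrightarrow> t \<le> d x y \<Longrightarrow> c t \<in> M"
  by (auto simp: geodesic_def)

lemma geodesic_dist:
  "geodesic x y c \<Longrightarrow> s \<in> {0..d x y} \<Longrightarrow> t \<in> {0..d x y} \<Longrightarrow> d (c s) (c t) = \<bar>s - t\<bar>"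
  by (auto simp: geodesic_def)

lemma geodesic_dist_start:
  assumes "geodesic x y c" "0 \<le> t" "t \<le> d x y"
  shows "d x (c t) = t"
  using geodesic_dist[OF assms(1), of 0 t] assms by (auto simp: geodesic_def)

lemma geodesic_initial:
  assumes "geodesic x y c" "0 \<le> t" "t \<le> d x y"
  shows "geodesic x (c t) c"
  using assms geodesic_dist_start[OF assms] by (auto simp: geodesic_def)

lemma geodesic_ray_initial:
  assumes "geodesic_ray c" "0 \<le> t"
  shows "geodesic (c 0) (c t) c" "d (c 0) (c t) = t"
proof -
  show *: "d (c 0) (c t) = t"
    using assms by (auto simp: geodesic_ray_def)
  show "geodesic (c 0) (c t) c"
    using assms unfolding geodesic_def * by (auto simp: geodesic_ray_def)
qed

text \<open>Components of product geodesics have constant speed, possibly zero. Parametrising over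
  the unit interval treats both cases alike.\<close>

lemma affine_geodesic:
  assumes "\<And>s. s \<in> {0..1} \<Longrightarrow> \<gamma> s \<in> M" "\<gamma> 0 = x" "\<gamma> 1 = y"
    and "\<And>s t. s \<in> {0..1} \<Longrightarrow> t \<in> {0..1} \<Longrightarrow> d (\<gamma> s) (\<gamma> t) = \<bar>s - t\<bar> * d x y"
  obtains c where "geodesic x y c" "\<And>a. a \<in> {0..1} \<Longrightarrow> c (a * d x y) = \<gamma> a"
proof
  let ?c = "\<lambda>t. \<gamma> (t / d x y)"
  have xy: "x \<in> M" "y \<in> M"
    using assms(1)[of 0] assms(1)[of 1] assms(2,3) by auto
  have div: "t / d x y \<in> {0..1}" if "t \<in> {0..d x y}" for t
    using that by (auto simp: divide_le_eq_1)
  show "?c (a * d x y) = \<gamma> a" if "a \<in> {0..1}" for a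
  \<comment> \<open>For coinciding end points the quotient \<open>t / d x y\<close> is 0, and this
    is consistent because \<gamma> is then constant.\<close>
  proof (cases "d x y = 0")
    case True
    then show ?thesis
      using assms(4)[of a 0] assms(1)[of a] assms(1)[of 0] that by auto
  qed simp
  have "?c (d x y) = y"
    using assms(2,3) zero[OF xy] by (cases "d x y = 0") simp_all
  moreover have "d (?c s) (?c t) = \<bar>s - t\<bar>" if "s \<in> {0..d x y}" "t \<in> {0..d x y}" for s t
  proof -
    have "d (?c s) (?c t) = \<bar>(s - t) / d x y\<bar> * d x y"
      using assms(4)[OF div div] that by (simp add: diff_divide_distrib)
    also have "\<dots> = \<bar>s - t\<bar>"
      using that by (cases "d x y = 0") (simp_all add: abs_divide)
    finally show ?thesis .
  qed
  ultimately show "geodesic x y ?c"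
    using div assms(1,2) unfolding geodesic_def by (intro conjI ballI funcsetI) simp_all
qed

section \<open>Asymptote classes and points of the visual boundary\<close>

lemma equiv_asymptotic: "equiv (Collect geodesic_ray) asymptotic"
proof (rule equivI)
  show "asymptotic \<subseteq> Collect geodesic_ray \<times> Collect geodesic_ray"
    by (auto simp: asymptotic_def)
  show "refl_on (Collect geodesic_ray) asymptotic"
  proof (rule refl_onI)
    fix c assume "c \<in> Collect geodesic_ray"
    then show "(c, c) \<in> asymptotic"
      by (auto simp: asymptotic_def geodesic_ray_def intro!: exI[of _ 0])
  qed
  show "sym asymptotic"
    by (auto simp: sym_def asymptotic_def commute)
  show "trans asymptotic"
  proof (rule transI)
    fix a b c assume "(a, b) \<in> asymptotic" "(b, c) \<in> asymptotic"
    then obtain K L where K: "\<And>t. t \<ge> 0 \<Longrightarrow> d (a t) (b t) \<le> K"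
      and L: "\<And>t. t \<ge> 0 \<Longrightarrow> d (b t) (c t) \<le> L"
      and rays: "geodesic_ray a" "geodesic_ray b" "geodesic_ray c"
      by (auto simp: asymptotic_def)
    have "d (a t) (c t) \<le> K + L" if "t \<ge> 0" for t
    proof -
      have "a t \<in> M" "b t \<in> M" "c t \<in> M"
        using rays that by (auto simp: geodesic_ray_def)
      then show ?thesis
        using triangle[of "a t" "b t" "c t"] K[OF that] L[OF that] by linarith
    qed
    then show "(a, c) \<in> asymptotic"
      using rays by (auto simp: asymptotic_def)
  qed
qed

lemma asymptotic_class_in_visual_boundary:
  "geodesic_ray c \<Longrightarrow> asymptotic `` {c} \<in> visual_boundary"
  by (simp add: visual_boundary_def quotientI)

lemma geodesic_ray_in_own_class: "geodesic_ray c \<Longrightarrow> c \<in> asymptotic `` {c}"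
  using equiv_class_self[OF equiv_asymptotic] by auto

lemma visual_boundary_class:
  assumes "\<xi> \<in> visual_boundary" "c \<in> \<xi>"
  shows "geodesic_ray c" "\<xi> = asymptotic `` {c}"
proof -
  from assms(1) obtain b where b: "geodesic_ray b" "\<xi> = asymptotic `` {b}"
    by (auto simp: visual_boundary_def elim: quotientE)
  with assms(2) have "(b, c) \<in> asymptotic"
    by auto
  then show "geodesic_ray c" "\<xi> = asymptotic `` {c}"
    using b equiv_class_eq[OF equiv_asymptotic] by (auto simp: asymptotic_def)
qed

lemma visual_boundary_asymptotic:
  assumes "\<xi> \<in> visual_boundary" "c \<in> \<xi>" "c' \<in> \<xi>"
  shows "(c, c') \<in> asymptotic"
  using visual_boundary_class[OF assms(1,2)] assms(3) by auto

section \<open>Cone neighbourhoods, limit sets and their compactification\<close>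

lemma Inl_in_cone_nbhd:
  "Inl x \<in> cone_nbhd c r \<epsilon> \<longleftrightarrow>
     x \<in> M \<and> r < d (c 0) x \<and> (\<exists>\<sigma>. geodesic (c 0) x \<sigma> \<and> d (\<sigma> r) (c r) < \<epsilon>)"
  by (auto simp: cone_nbhd_def)

lemma Inr_in_cone_nbhd:
  "Inr \<xi> \<in> cone_nbhd c r \<epsilon> \<longleftrightarrow>
     \<xi> \<in> visual_boundary \<and> (\<exists>\<rho>\<in>\<xi>. \<rho> 0 = c 0 \<and> d (\<rho> r) (c r) < \<epsilon>)"
  by (auto simp: cone_nbhd_def)

lemma openin_cone_nbhd:
  "geodesic_ray c \<Longrightarrow> 0 < r \<Longrightarrow> 0 < \<epsilon> \<Longrightarrow> openin (cone_topology (c 0)) (cone_nbhd c r \<epsilon>)"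
  unfolding cone_topology_def by (rule topology_generated_by_Basis) blast

text \<open>A class need not contain a ray from \<open>b\<close> a priori. Subbasic sets of the cone
  topology at \<open>b\<close> only contain boundary points that do, so lying in its topspace
  supplies the ray.\<close>

lemma limset_ray:
  assumes "\<xi> \<in> limset G \<phi> b"
  obtains \<rho> where "\<rho> \<in> \<xi>" "\<rho> 0 = b"
proof -
  have "Inr \<xi> \<in> topspace (cone_topology b)"
    using assms by (auto simp: limset_def in_closure_of)
  then obtain c r \<epsilon> where "c 0 = b" "Inr \<xi> \<in> cone_nbhd c r \<epsilon>"
    by (auto simp: cone_topology_def)
  then show thesis
    using that by (auto simp: Inr_in_cone_nbhd)
qed

lemma openin_limset_compactification_point:
  "g \<in> carrier G \<Longrightarrow> openin (limset_compactification G \<phi> b) {Inl g}"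
  unfolding limset_compactification_def
  by (intro topology_generated_by_Basis UnI1 CollectI exI[of _ g]) simp

lemma openin_limset_compactification_trace:
  "openin (cone_topology b) U \<Longrightarrow> openin (limset_compactification G \<phi> b)
    (Inl ` {g \<in> carrier G. Inl (\<phi> g b) \<in> U} \<union> Inr ` {\<xi> \<in> limset G \<phi> b. Inr \<xi> \<in> U})"
  unfolding limset_compactification_def
  by (intro topology_generated_by_Basis UnI2 CollectI exI[of _ U]) simp

lemma limset_meets_orbit:
  assumes "\<xi> \<in> limset G \<phi> b" "openin (cone_topology b) W" "Inr \<xi> \<in> W"
  obtains g where "g \<in> carrier G" "Inl (\<phi> g b) \<in> W"
  using assms by (auto simp: limset_def in_closure_of orbit_def)

lemma topspace_limset_compactification:
  "topspace (limset_compactification G \<phi> b) = Inl ` carrier G \<union> Inr ` limset G \<phi> b"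
    (is "?T = ?R")
proof
  show "?T \<subseteq> ?R"
    unfolding limset_compactification_def topology_generated_by_topspace by blast
  have "Inl g \<in> ?T" if "g \<in> carrier G" for g
    using openin_subset[OF openin_limset_compactification_point[OF that]] by simp
  moreover have "Inr \<xi> \<in> ?T" if "\<xi> \<in> limset G \<phi> b" for \<xi>
  proof -
    have "Inr \<xi> \<in> topspace (cone_topology b)"
      using that by (simp add: limset_def in_closure_of)
    then show ?thesis
      using openin_subset[OF openin_limset_compactification_trace[OF openin_topspace], of G \<phi> b] that
      by auto
  qed
  ultimately show "?R \<subseteq> ?T"
    by blast
qed

lemma semi_simple_iff:
  "semi_simple f \<longleftrightarrow> (\<exists>x\<in>M. \<forall>y\<in>M. d x (f x) \<le> d y (f y))"
proof -
  have bdd: "bdd_below ((\<lambda>y. d y (f y)) ` M)"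
    by (rule bdd_belowI[of _ 0]) auto
  have "d x (f x) = (INF y\<in>M. d y (f y)) \<longleftrightarrow> (\<forall>y\<in>M. d x (f x) \<le> d y (f y))" if "x \<in> M" for x
  proof
    assume "d x (f x) = (INF y\<in>M. d y (f y))"
    then show "\<forall>y\<in>M. d x (f x) \<le> d y (f y)"
      using cINF_lower[OF bdd] by auto
  next
    assume "\<forall>y\<in>M. d x (f x) \<le> d y (f y)"
    then show "d x (f x) = (INF y\<in>M. d y (f y))"
      using that by (intro antisym cINF_greatest cINF_lower[OF bdd]) auto
  qed
  then show ?thesis
    by (auto simp: semi_simple_def)
qed

end

section \<open>Comparison triangles in the Euclidean plane\<close>

lemma comparison_triangle_exists:
  fixes A B C :: real
  assumes "0 \<le> A" "0 \<le> B" "0 \<le> C" "A \<le> B + C" "B \<le> A + C" "C \<le> A + B"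
  obtains p q r :: "real^2" where "dist p q = A" "dist p r = B" "dist q r = C"
proof -
  have *: "dist v w = sqrt ((v $ 1 - w $ 1)\<^sup>2 + (v $ 2 - w $ 2)\<^sup>2)" for v w :: "real^2"
    by (simp add: dist_vec_def L2_set_def sum_2 dist_real_def)
  show thesis
  proof (cases "A = 0")
    case True
    then show ?thesis
      using assms by (intro that[of 0 0 "vector [B, 0]"]) (auto simp: *)
  next
    case False
    \<comment> \<open>With \<open>p\<close> at the origin and \<open>q = (A, 0)\<close>, the law of
      cosines forces this first coordinate of \<open>r\<close>. The triangle inequalities amount to
      \<open>\<bar>x\<bar> \<le> B\<close>, which makes the second coordinate a genuine square
      root.\<close>
    define x where "x = (A\<^sup>2 + B\<^sup>2 - C\<^sup>2) / (2 * A)"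
    have Ax: "2 * A * x = A\<^sup>2 + B\<^sup>2 - C\<^sup>2"
      using False by (simp add: x_def)
    have "(A - B)\<^sup>2 \<le> C\<^sup>2"
      using assms by (intro abs_le_square_iff[THEN iffD1]) auto
    moreover have "C\<^sup>2 \<le> (A + B)\<^sup>2"
      using assms by (intro power_mono) auto
    ultimately have "2 * A * \<bar>x\<bar> \<le> 2 * A * B"
      using assms Ax by (cases "x \<ge> 0") (auto simp: power2_eq_square algebra_simps)
    then have "\<bar>x\<bar> \<le> B"
      using False assms by simp
    then have x: "x\<^sup>2 \<le> B\<^sup>2"
      using assms by (intro abs_le_square_iff[THEN iffD1]) auto
    let ?r = "vector [x, sqrt (B\<^sup>2 - x\<^sup>2)] :: real^2"
    have "(A - x)\<^sup>2 + (B\<^sup>2 - x\<^sup>2) = C\<^sup>2"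
      using Ax by (simp add: power2_eq_square algebra_simps)
    then show ?thesis
      using assms x by (intro that[of 0 "vector [A, 0]" ?r]) (auto simp: *)
  qed
qed

text \<open>With \<open>u = q - p\<close> and \<open>v = r - p\<close>, this is the expansion of the
  squared norm of \<open>a u - b v\<close>, twice the inner product of \<open>u\<close> and
  \<open>v\<close> being written as |u|^2 + |v|^2 - |u - v|^2. Only side lengths remain on the
  right, so the formula can be transferred to triangles in other spaces.\<close>

lemma dist_points_on_sides:
  fixes p q r :: "'v::real_inner"
  shows "(dist (p + a *\<^sub>R (q - p)) (p + b *\<^sub>R (r - p)))\<^sup>2 =
    a\<^sup>2 * (dist p q)\<^sup>2 + b\<^sup>2 * (dist p r)\<^sup>2
      - a * b * ((dist p q)\<^sup>2 + (dist p r)\<^sup>2 - (dist q r)\<^sup>2)"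
proof -
  define u v where "u = q - p" and "v = r - p"
  have [simp]: "q = p + u" "r = p + v"
    by (simp_all add: u_def v_def)
  show ?thesis
    unfolding dist_norm power2_norm_eq_inner
    by (simp add: inner_diff inner_add algebra_simps inner_commute power2_eq_square)
qed

context CAT0_space
begin

text \<open>
  The comparison axiom becomes affine in the squares of the three side lengths, which is why it
  passes to \<open>\<ell>\<^sup>2\<close>-products.
\<close>

lemma CAT0_inequality:
  assumes "geodesic p q c" "geodesic p r c'" "p \<in> M" "q \<in> M" "r \<in> M"
    and "a \<in> {0..1}" "b \<in> {0..1}"
  shows "(d (c (a * d p q)) (c' (b * d p r)))\<^sup>2 \<le>
    a\<^sup>2 * (d p q)\<^sup>2 + b\<^sup>2 * (d p r)\<^sup>2 - a * b * ((d p q)\<^sup>2 + (d p r)\<^sup>2 - (d q r)\<^sup>2)"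
proof -
  obtain p' q' r' :: "real^2" where t: "dist p' q' = d p q" "dist p' r' = d p r" "dist q' r' = d q r"
    using comparison_triangle_exists[of "d p q" "d p r" "d q r"]
      triangle[of p r q] triangle[of p q r] triangle[of q p r] assms
    by (auto simp: commute)
  let ?x = "p' + a *\<^sub>R (q' - p')" and ?y = "p' + b *\<^sub>R (r' - p')"
  have "?x \<in> closed_segment p' q'" "?y \<in> closed_segment p' r'"
    using assms by (auto simp: in_segment algebra_simps)
  moreover have "dist p' ?x = a * d p q" "dist p' ?y = b * d p r"
    using assms by (simp_all add: dist_norm norm_minus_commute flip: t)
  moreover have "a * d p q \<in> {0..d p q}" "b * d p r \<in> {0..d p r}"
    using assms by (auto intro: mult_left_le_one_le)
  ultimately have "d (c (a * d p q)) (c' (b * d p r)) \<le> dist ?x ?y"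
    using assms by (intro CAT0_comparison[of p q r c c' p' q' r']) (auto simp: t)
  then have "(d (c (a * d p q)) (c' (b * d p r)))\<^sup>2 \<le> (dist ?x ?y)\<^sup>2"
    by (intro power_mono) auto
  then show ?thesis
    by (simp only: dist_points_on_sides t)
qed

text \<open>Cutting both geodesics at \<open>m\<close> gives an isosceles triangle, in which time
  \<open>t\<close> is the same fraction \<open>t / m\<close> of both sides. For equal fractions the
  terms of the two sides at \<open>p\<close> cancel in \<open>CAT0_inequality\<close>, leaving the
  third side. Multiplying out by \<open>m\<close> includes the degenerate case
  \<open>m = 0\<close>.\<close>

lemma geodesic_contraction:
  assumes "geodesic p q c" "geodesic p r c'" "p \<in> M" "q \<in> M" "r \<in> M"
    and "0 \<le> t" "t \<le> m" "m \<le> d p q" "m \<le> d p r"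
  shows "m * d (c t) (c' t) \<le> t * d (c m) (c' m)"
proof (cases "m = 0")
  case False
  let ?a = "t / m"
  have cm: "d p (c m) = m" "d p (c' m) = m" "c m \<in> M" "c' m \<in> M"
    using assms by (auto intro!: geodesic_dist_start geodesic_in_space)
  have "(d (c (?a * d p (c m))) (c' (?a * d p (c' m))))\<^sup>2 \<le> ?a\<^sup>2 * (d p (c m))\<^sup>2 + ?a\<^sup>2 * (d p (c' m))\<^sup>2
      - ?a * ?a * ((d p (c m))\<^sup>2 + (d p (c' m))\<^sup>2 - (d (c m) (c' m))\<^sup>2)"
    using assms cm False
    by (intro CAT0_inequality geodesic_initial[OF assms(1)] geodesic_initial[OF assms(2)]) auto
  then have "(d (c t) (c' t))\<^sup>2 \<le> (?a * d (c m) (c' m))\<^sup>2"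
    using False unfolding cm by (simp add: power2_eq_square algebra_simps)
  then have "d (c t) (c' t) \<le> ?a * d (c m) (c' m)"
    by (rule power2_le_imp_le) (use assms in simp)
  then have "m * d (c t) (c' t) \<le> m * (?a * d (c m) (c' m))"
    by (rule mult_left_mono) (use assms in simp)
  also have "\<dots> = t * d (c m) (c' m)"
    using False by simp
  finally show ?thesis .
qed (use assms in simp)

text \<open>The factor 2 pays for unequal lengths: cutting both geodesics at the shorter length
  moves the end point of the longer one by at most \<open>d q r\<close>. Contraction towards
  \<open>p\<close> then handles all earlier times.\<close>

lemma geodesics_close:
  assumes c: "geodesic p q c" and c': "geodesic p r c'" and M: "p \<in> M" "q \<in> M" "r \<in> M"
    and t: "0 < t" "t \<le> d p q" "t \<le> d p r"
  shows "d (c t) (c' t) \<le> 2 * d q r"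
proof -
  let ?m = "min (d p q) (d p r)"
  have in_M: "c ?m \<in> M" "c' ?m \<in> M"
    using assms by (auto intro!: geodesic_in_space)
  have end_q: "d (c ?m) q = d p q - ?m"
    using geodesic_dist[OF c, of ?m "d p q"] c by (auto simp: geodesic_def)
  have end_r: "d (c' ?m) r = d p r - ?m"
    using geodesic_dist[OF c', of ?m "d p r"] c' by (auto simp: geodesic_def)
  have "d (c ?m) (c' ?m) \<le> d (c ?m) q + d q r + d (c' ?m) r"
    using triangle[of "c ?m" q "c' ?m"] triangle[of q r "c' ?m"] in_M M by (simp add: commute)
  moreover have "\<bar>d p q - d p r\<bar> \<le> d q r"
    using triangle[of p q r] triangle[of p r q] M by (simp add: commute)
  ultimately have *: "d (c ?m) (c' ?m) \<le> 2 * d q r"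
    using end_q end_r by linarith
  have "?m * d (c t) (c' t) \<le> t * d (c ?m) (c' ?m)"
    using t by (intro geodesic_contraction[OF c c' M]) auto
  also have "\<dots> \<le> ?m * d (c ?m) (c' ?m)"
    using t by (intro mult_right_mono) auto
  finally show ?thesis
    using * t by simp
qed

text \<open>Contraction from time \<open>m\<close> bounds the distance at time \<open>t\<close> by
  \<open>t * K / m\<close>, and \<open>m\<close> may be arbitrarily large.\<close>

lemma asymptotic_rays_eq:
  assumes "(c, c') \<in> asymptotic" "c 0 = c' 0" "0 \<le> t"
  shows "c t = c' t"
proof -
  obtain K where K: "\<And>t. t \<ge> 0 \<Longrightarrow> d (c t) (c' t) \<le> K"
    and rays: "geodesic_ray c" "geodesic_ray c'"
    using assms(1) by (force simp: asymptotic_def)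
  then have in_M: "c u \<in> M" "c' u \<in> M" if "0 \<le> u" for u
    using that by (auto simp: geodesic_ray_def)
  have "m * d (c t) (c' t) \<le> t * K" if "t \<le> m" for m
  proof -
    have "0 \<le> m"
      using that assms by simp
    then have "m * d (c t) (c' t) \<le> t * d (c m) (c' m)"
      using that assms(2,3) in_M geodesic_ray_initial[OF rays(1), of m]
        geodesic_ray_initial[OF rays(2), of m]
      by (intro geodesic_contraction[of "c 0" "c m" _ "c' m"]) auto
    also have "\<dots> \<le> t * K"
      using K[OF \<open>0 \<le> m\<close>] assms by (intro mult_left_mono)
    finally show ?thesis .
  qed
  note bound = this
  have "d (c t) (c' t) = 0"
  proof (rule ccontr)
    assume "d (c t) (c' t) \<noteq> 0"
    then have pos: "d (c t) (c' t) > 0"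
      by (simp add: less_le)
    \<comment> \<open>Chosen so that \<open>m * d (c t) (c' t)\<close> is \<open>t * K + 1\<close>,
      just beyond the bound; \<open>max t m\<close> below respects the restriction
      \<open>t \<le> m\<close>.\<close>
    define m where "m = (t * K + 1) / d (c t) (c' t)"
    have "m * d (c t) (c' t) \<le> max t m * d (c t) (c' t)"
      using pos by (intro mult_right_mono) auto
    also have "\<dots> \<le> t * K"
      by (rule bound) simp
    finally show False
      using pos by (simp add: m_def)
  qed
  then show ?thesis
    using in_M[OF assms(3)] by simp
qed

end

section \<open>Products of CAT(0) spaces\<close>

text \<open>This is the equality case of Cauchy-Schwarz: |e|^2 is at most the sum of the inner
  products of \<open>e\<close> with \<open>u\<close>, \<open>v\<close>, \<open>w\<close>, which is
  at most |e| (|u| + |v| + |w|), hence at most |e|^2 again. So each of the three Cauchy-Schwarz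
  inequalities is an equality.\<close>

lemma collinear_if_norm_sum_le:
  fixes u v w e :: "'v::real_inner"
  assumes "inner e e \<le> inner e (u + v + w)" "norm u + norm v + norm w \<le> norm e"
  shows "norm e *\<^sub>R v = norm v *\<^sub>R e"
proof -
  have "inner e u \<le> norm e * norm u" "inner e v \<le> norm e * norm v" "inner e w \<le> norm e * norm w"
    by (rule norm_cauchy_schwarz)+
  moreover have "norm e * (norm u + norm v + norm w) \<le> norm e * norm e"
    using assms(2) by (intro mult_left_mono) auto
  ultimately have "inner e v = norm e * norm v"
    using assms(1) by (simp add: inner_add_right distrib_left power2_norm_eq_inner[symmetric]
        power2_eq_square)
  then show ?thesis
    by (simp add: norm_cauchy_schwarz_eq)
qed

locale CAT0_space12 = Y1: CAT0_space M1 d1 + Y2: CAT0_space M2 d2 for M1 d1 M2 d2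

sublocale CAT0_space12 \<subseteq> Metric_space12 ..

context CAT0_space12
begin

abbreviation pd where "pd \<equiv> prod_dist d1 d2"

lemma pd_eq: "pd x y = norm (d1 (fst x) (fst y), d2 (snd x) (snd y))"
  by (simp add: prod_dist_def case_prod_unfold norm_Pair)

lemma pd_squared: "(pd x y)\<^sup>2 = (d1 (fst x) (fst y))\<^sup>2 + (d2 (snd x) (snd y))\<^sup>2"
  by (simp add: prod_dist_def case_prod_unfold)

text \<open>Record a pair of points by the plane vector of its two factor distances, whose norm is
  the product distance. Along a geodesic, the vectors of three consecutive pieces dominate the
  vector of the end points coordinatewise, while their norms add up to its norm. They must therefore
  be parallel to it, which says that both components move at constant speed.\<close>

lemma product_geodesic_components:
  assumes c: "Prod_metric.geodesic p q c" and "s \<in> {0..1}" "t \<in> {0..1}"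
  shows "d1 (fst (c (s * pd p q))) (fst (c (t * pd p q))) = \<bar>s - t\<bar> * d1 (fst p) (fst q)"
    and "d2 (snd (c (s * pd p q))) (snd (c (t * pd p q))) = \<bar>s - t\<bar> * d2 (snd p) (snd q)"
proof -
  let ?L = "pd p q"
  define v where "v x y = (d1 (fst x) (fst y), d2 (snd x) (snd y))" for x y
  have v: "pd x y = norm (v x y)" for x y
    by (simp add: pd_eq v_def)
  have main: "v (c (s * ?L)) (c (t * ?L)) = \<bar>s - t\<bar> *\<^sub>R v p q"
    if st: "s \<in> {0..1}" "t \<in> {0..1}" "s \<le> t" for s t
  proof -
    let ?x = "c (s * ?L)" and ?y = "c (t * ?L)"
    have L: "0 \<le> ?L"
      by simp
    have I: "0 \<in> {0..?L}" "s * ?L \<in> {0..?L}" "t * ?L \<in> {0..?L}" "?L \<in> {0..?L}"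
      using st by (auto intro: mult_left_le_one_le)
    have sl: "s * ?L \<le> t * ?L"
      using st by (intro mult_right_mono) auto
    have ends: "c 0 = p" "c ?L = q"
      using c by (auto simp: Prod_metric.geodesic_def)
    have M: "p \<in> M1 \<times> M2" "?x \<in> M1 \<times> M2" "?y \<in> M1 \<times> M2" "q \<in> M1 \<times> M2"
      using Prod_metric.geodesic_in_space[OF c] I ends by (auto simp del: mem_Times_iff)
        (metis Prod_metric.geodesic_in_space[OF c] L order_refl)+
    have lens: "norm (v p ?x) = s * ?L" "norm (v ?x ?y) = (t - s) * ?L" "norm (v ?y q) = (1 - t) * ?L"
      using Prod_metric.geodesic_dist[OF c, of 0 "s * ?L"] Prod_metric.geodesic_dist[OF c, of "s * ?L" "t * ?L"]
        Prod_metric.geodesic_dist[OF c, of "t * ?L" ?L] I ends sl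
      by (auto simp: algebra_simps simp flip: v)
    have "d1 (fst p) (fst q) \<le> d1 (fst p) (fst ?x) + d1 (fst ?x) (fst ?y) + d1 (fst ?y) (fst q)"
      using Y1.triangle[of "fst p" "fst ?x" "fst q"] Y1.triangle[of "fst ?x" "fst ?y" "fst q"] M
      by (auto simp: mem_Times_iff)
    moreover have "d2 (snd p) (snd q) \<le> d2 (snd p) (snd ?x) + d2 (snd ?x) (snd ?y) + d2 (snd ?y) (snd q)"
      using Y2.triangle[of "snd p" "snd ?x" "snd q"] Y2.triangle[of "snd ?x" "snd ?y" "snd q"] M
      by (auto simp: mem_Times_iff)
    \<comment> \<open>The coordinates of \<open>v p q\<close> are nonnegative, so the inner product
      with it preserves the coordinatewise triangle inequalities.\<close>
    ultimately have "inner (v p q) (v p q) \<le> inner (v p q) (v p ?x + v ?x ?y + v ?y q)"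
      unfolding v_def by (auto simp: inner_prod_def intro!: add_mono mult_left_mono)
    then have "norm (v p q) *\<^sub>R v ?x ?y = norm (v ?x ?y) *\<^sub>R v p q"
      by (rule collinear_if_norm_sum_le) (simp only: lens, simp add: algebra_simps flip: v)
    then have "?L *\<^sub>R v ?x ?y = ((t - s) * ?L) *\<^sub>R v p q"
      unfolding lens(2) by (simp only: v)
    then have eq: "?L *\<^sub>R v ?x ?y = ?L *\<^sub>R (\<bar>s - t\<bar> *\<^sub>R v p q)"
      using st by (simp add: mult.commute)
    show ?thesis
    proof (cases "?L = 0")
      case True
      then show ?thesis
        using lens(2) v[of p q] by simp
    next
      case False
      then show ?thesis
        using eq by (simp del: scaleR_scaleR)
    qed
  qed
  have sym: "v x y = v y x" for x y
    by (simp add: v_def Y1.commute Y2.commute)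
  have "v (c (s * ?L)) (c (t * ?L)) = \<bar>s - t\<bar> *\<^sub>R v p q"
  proof (cases "s \<le> t")
    case True
    then show ?thesis
      by (rule main[OF assms(2,3)])
  next
    case False
    then have "v (c (t * ?L)) (c (s * ?L)) = \<bar>t - s\<bar> *\<^sub>R v p q"
      by (intro main[OF assms(3,2)]) simp
    then show ?thesis
      unfolding sym[of "c (s * ?L)"] by (simp only: abs_minus_commute)
  qed
  then show "d1 (fst (c (s * ?L))) (fst (c (t * ?L))) = \<bar>s - t\<bar> * d1 (fst p) (fst q)"
    and "d2 (snd (c (s * ?L))) (snd (c (t * ?L))) = \<bar>s - t\<bar> * d2 (snd p) (snd q)"
    by (auto simp: v_def)
qed

lemma product_geodesic_projections:
  assumes c: "Prod_metric.geodesic p q c"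
  obtains c1 c2 where "Y1.geodesic (fst p) (fst q) c1" "Y2.geodesic (snd p) (snd q) c2"
    "\<And>a. a \<in> {0..1} \<Longrightarrow> c (a * pd p q) = (c1 (a * d1 (fst p) (fst q)), c2 (a * d2 (snd p) (snd q)))"
proof -
  have M: "c (a * pd p q) \<in> M1 \<times> M2" if "a \<in> {0..1}" for a
    using that by (intro Prod_metric.geodesic_in_space[OF c]) (auto intro: mult_left_le_one_le)
  have ends: "c (0 * pd p q) = p" "c (1 * pd p q) = q"
    using c by (auto simp: Prod_metric.geodesic_def)
  obtain c1 where c1: "Y1.geodesic (fst p) (fst q) c1"
    "\<And>a. a \<in> {0..1} \<Longrightarrow> c1 (a * d1 (fst p) (fst q)) = fst (c (a * pd p q))"
    by (rule Y1.affine_geodesic[of "\<lambda>a. fst (c (a * pd p q))" "fst p" "fst q"])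
      (use M ends product_geodesic_components(1)[OF c] in \<open>auto simp: mem_Times_iff\<close>)
  obtain c2 where c2: "Y2.geodesic (snd p) (snd q) c2"
    "\<And>a. a \<in> {0..1} \<Longrightarrow> c2 (a * d2 (snd p) (snd q)) = snd (c (a * pd p q))"
    by (rule Y2.affine_geodesic[of "\<lambda>a. snd (c (a * pd p q))" "snd p" "snd q"])
      (use M ends product_geodesic_components(2)[OF c] in \<open>auto simp: mem_Times_iff\<close>)
  show thesis
    by (rule that[OF c1(1) c2(1)]) (simp add: c1(2) c2(2))
qed

lemma product_CAT0: "CAT0_space (M1 \<times> M2) pd"
proof
  fix x y assume "x \<in> M1 \<times> M2" "y \<in> M1 \<times> M2"
  then obtain c1 c2 where c1: "Y1.geodesic (fst x) (fst y) c1" and c2: "Y2.geodesic (snd x) (snd y) c2"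
    using Y1.geodesic_exists[of "fst x" "fst y"] Y2.geodesic_exists[of "snd x" "snd y"]
    by (auto simp: mem_Times_iff)
  let ?D1 = "d1 (fst x) (fst y)" and ?D2 = "d2 (snd x) (snd y)"
  let ?\<gamma> = "\<lambda>a. (c1 (a * ?D1), c2 (a * ?D2))"
  have I: "a * ?D1 \<in> {0..?D1}" "a * ?D2 \<in> {0..?D2}" if "a \<in> {0..1}" for a
    using that by (auto intro: mult_left_le_one_le)
  have len: "pd (?\<gamma> s) (?\<gamma> t) = \<bar>s - t\<bar> * pd x y" if "s \<in> {0..1}" "t \<in> {0..1}" for s t
  proof -
    have "d1 (c1 (s * ?D1)) (c1 (t * ?D1)) = \<bar>s - t\<bar> * ?D1"
      using Y1.geodesic_dist[OF c1 I(1) I(1)] that by (simp add: abs_mult flip: left_diff_distrib)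
    moreover have "d2 (c2 (s * ?D2)) (c2 (t * ?D2)) = \<bar>s - t\<bar> * ?D2"
      using Y2.geodesic_dist[OF c2 I(2) I(2)] that by (simp add: abs_mult flip: left_diff_distrib)
    ultimately have "pd (?\<gamma> s) (?\<gamma> t) = norm (\<bar>s - t\<bar> *\<^sub>R (?D1, ?D2))"
      by (simp add: pd_eq)
    then show ?thesis
      by (simp only: norm_scaleR pd_eq abs_abs)
  qed
  show "\<exists>c. Prod_metric.geodesic x y c"
    by (rule Prod_metric.affine_geodesic[of ?\<gamma> x y, OF _ _ _ len])
      (use I c1 c2 Y1.geodesic_in_space[OF c1] Y2.geodesic_in_space[OF c2] in
        \<open>auto simp: Y1.geodesic_def Y2.geodesic_def\<close>)
next
  fix p q r c c' s t and p' q' r' x' y' :: "real^2"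
  assume M: "p \<in> M1 \<times> M2" "q \<in> M1 \<times> M2" "r \<in> M1 \<times> M2"
    and c: "Prod_metric.geodesic p q c" and c': "Prod_metric.geodesic p r c'"
    and tri: "dist p' q' = pd p q" "dist p' r' = pd p r" "dist q' r' = pd q r"
    and x': "x' \<in> closed_segment p' q'" "dist p' x' = s"
    and y': "y' \<in> closed_segment p' r'" "dist p' y' = t"
  \<comment> \<open>Comparison points are replaced by their fractions along the sides, since the
    same fractions locate the points on the component geodesics.\<close>
  obtain a where a: "a \<in> {0..1}" "x' = p' + a *\<^sub>R (q' - p')"
    using x' by (auto simp: in_segment algebra_simps)
  obtain b where b: "b \<in> {0..1}" "y' = p' + b *\<^sub>R (r' - p')"
    using y' by (auto simp: in_segment algebra_simps)
  have s: "s = a * pd p q" and t: "t = b * pd p r"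
    using a b x' y' by (auto simp: dist_norm norm_minus_commute simp flip: tri)
  obtain c1 c2 where c12: "Y1.geodesic (fst p) (fst q) c1" "Y2.geodesic (snd p) (snd q) c2"
    "\<And>a. a \<in> {0..1} \<Longrightarrow> c (a * pd p q) = (c1 (a * d1 (fst p) (fst q)), c2 (a * d2 (snd p) (snd q)))"
    by (rule product_geodesic_projections[OF c]) blast
  obtain c1' c2' where c12': "Y1.geodesic (fst p) (fst r) c1'" "Y2.geodesic (snd p) (snd r) c2'"
    "\<And>a. a \<in> {0..1} \<Longrightarrow> c' (a * pd p r) = (c1' (a * d1 (fst p) (fst r)), c2' (a * d2 (snd p) (snd r)))"
    by (rule product_geodesic_projections[OF c']) blast
  have "(pd (c s) (c' t))\<^sup>2 =
      (d1 (c1 (a * d1 (fst p) (fst q))) (c1' (b * d1 (fst p) (fst r))))\<^sup>2 +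
      (d2 (c2 (a * d2 (snd p) (snd q))) (c2' (b * d2 (snd p) (snd r))))\<^sup>2"
    using a b by (simp add: pd_squared s t c12(3) c12'(3))
  \<comment> \<open>The two factor inequalities add up to the planar formula, because each squared
    side length of the product is the sum of the factor ones.\<close>
  also have "\<dots> \<le> (dist x' y')\<^sup>2"
    using Y1.CAT0_inequality[OF c12(1) c12'(1), of a b] Y2.CAT0_inequality[OF c12(2) c12'(2), of a b] M a b
    unfolding a(2) b(2) dist_points_on_sides tri pd_squared
    by (simp add: mem_Times_iff algebra_simps)
  finally show "pd (c s) (c' t) \<le> dist x' y'"
    by (rule power2_le_imp_le) simp
qed

end

lemma product_proper_CAT0:
  assumes "proper_CAT0_space M1 d1" "proper_CAT0_space M2 d2"
  shows "proper_CAT0_space (M1 \<times> M2) (prod_dist d1 d2)"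
proof -
  interpret Y1: proper_CAT0_space M1 d1 by fact
  interpret Y2: proper_CAT0_space M2 d2 by fact
  interpret CAT0_space12 M1 d1 M2 d2 ..
  interpret CAT0_space "M1 \<times> M2" "prod_dist d1 d2" by (rule product_CAT0)
  show ?thesis
  proof
    fix x r assume "x \<in> M1 \<times> M2"
    then have "compactin Prod_metric.mtopology (Y1.mcball (fst x) r \<times> Y2.mcball (snd x) r)"
      by (simp add: mtopology_prod_metric compactin_Times Y1.proper Y2.proper mem_Times_iff)
    moreover have "Prod_metric.mcball x r \<subseteq> Y1.mcball (fst x) r \<times> Y2.mcball (snd x) r"
      using mcball_prod_metric_subset[of "fst x" "snd x" r] by simp
    ultimately show "compactin Prod_metric.mtopology (Prod_metric.mcball x r)"
      by (rule closed_compactin) auto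
  qed
qed


section \<open>Boundary maps induced by projections\<close>

text \<open>
  The assumption \<open>orbit_expansion\<close> keeps rays towards limit points of the orbit from being
  projected to a point.
\<close>

locale equivariant_projection =
  X: CAT0_space X d + Y: CAT0_space Y e
  for X :: "'a set" and d and Y :: "'b set" and e +
  fixes G :: "('g, 'm) monoid_scheme" and \<phi> :: "'g \<Rightarrow> 'a \<Rightarrow> 'a" and \<psi> :: "'g \<Rightarrow> 'b \<Rightarrow> 'b"
    and \<pi> :: "'a \<Rightarrow> 'b" and x\<^sub>0 :: 'a and y\<^sub>0 :: 'b and \<kappa> C :: real
  assumes proj_in: "\<And>p. p \<in> X \<Longrightarrow> \<pi> p \<in> Y"
    and proj_le: "\<And>p q. p \<in> X \<Longrightarrow> q \<in> X \<Longrightarrow> e (\<pi> p) (\<pi> q) \<le> d p q"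
    and proj_affine: "\<And>p q c s t. X.geodesic p q c \<Longrightarrow> s \<in> {0..1} \<Longrightarrow> t \<in> {0..1} \<Longrightarrow>
      e (\<pi> (c (s * d p q))) (\<pi> (c (t * d p q))) = \<bar>s - t\<bar> * e (\<pi> p) (\<pi> q)"
    and base: "x\<^sub>0 \<in> X" "\<pi> x\<^sub>0 = y\<^sub>0"
    and orbit: "\<And>g. g \<in> carrier G \<Longrightarrow> \<phi> g x\<^sub>0 \<in> X" "\<And>g. g \<in> carrier G \<Longrightarrow> \<pi> (\<phi> g x\<^sub>0) = \<psi> g y\<^sub>0"
    and scale_pos: "0 < \<kappa>"
    and orbit_expansion: "\<And>g. g \<in> carrier G \<Longrightarrow> \<kappa> * d x\<^sub>0 (\<phi> g x\<^sub>0) - C \<le> e y\<^sub>0 (\<psi> g y\<^sub>0)"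
begin

section \<open>Projected rays and their speed\<close>

lemma y0_in: "y\<^sub>0 \<in> Y"
  using base proj_in by auto

definition speed :: "(real \<Rightarrow> 'a) \<Rightarrow> real" where
  "speed \<rho> = e (\<pi> (\<rho> 0)) (\<pi> (\<rho> 1))"

text \<open>Reparametrisation by arc length. At speed zero the quotient is 0 and the curve rests at
  \<open>\<pi> (\<rho> 0)\<close>.\<close>

definition proj_ray :: "(real \<Rightarrow> 'a) \<Rightarrow> real \<Rightarrow> 'b" where
  "proj_ray \<rho> t = \<pi> (\<rho> (t / speed \<rho>))"

text \<open>The chosen ray is unique up to its irrelevant values at negative times.\<close>

definition boundary_map :: "(real \<Rightarrow> 'a) set \<Rightarrow> (real \<Rightarrow> 'b) set" where
  "boundary_map \<xi> = Y.asymptotic `` {proj_ray (SOME \<rho>. \<rho> \<in> \<xi> \<and> \<rho> 0 = x\<^sub>0)}"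

text \<open>\<open>proj_affine\<close> speaks of finite geodesics, so the ray is cut at some
  \<open>T\<close> beyond \<open>s\<close> and \<open>t\<close>. Taking \<open>T \<ge> 1\<close>
  puts the unit interval that defines \<open>speed\<close> on the same piece.\<close>

lemma dist_proj_along_ray:
  assumes "X.geodesic_ray \<rho>" "0 \<le> s" "0 \<le> t"
  shows "e (\<pi> (\<rho> s)) (\<pi> (\<rho> t)) = \<bar>s - t\<bar> * speed \<rho>"
proof -
  define T where "T = max (max s t) 1"
  have T: "0 < T" "s \<le> T" "t \<le> T" "1 \<le> T"
    by (auto simp: T_def)
  note ray = X.geodesic_ray_initial[OF assms(1), of T]
  have aff: "e (\<pi> (\<rho> (a * T))) (\<pi> (\<rho> (b * T))) = \<bar>a - b\<bar> * e (\<pi> (\<rho> 0)) (\<pi> (\<rho> T))"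
    if "a \<in> {0..1}" "b \<in> {0..1}" for a b
    using proj_affine[OF ray(1), of a b] ray(2) T that by simp
  have "speed \<rho> = e (\<pi> (\<rho> 0)) (\<pi> (\<rho> T)) / T"
    using aff[of 0 "1 / T"] T by (simp add: speed_def)
  moreover have "e (\<pi> (\<rho> s)) (\<pi> (\<rho> t)) = \<bar>s / T - t / T\<bar> * e (\<pi> (\<rho> 0)) (\<pi> (\<rho> T))"
    using aff[of "s / T" "t / T"] T assms(2,3) by simp
  moreover have "\<bar>s / T - t / T\<bar> = \<bar>s - t\<bar> / T"
    using T by (simp add: abs_divide flip: diff_divide_distrib)
  ultimately show ?thesis
    by simp
qed

lemma proj_ray_scaled: "0 < speed \<rho> \<Longrightarrow> proj_ray \<rho> (speed \<rho> * t) = \<pi> (\<rho> t)"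
  by (simp add: proj_ray_def)

lemma proj_ray_0: "proj_ray \<rho> 0 = \<pi> (\<rho> 0)"
  by (simp add: proj_ray_def)

lemma geodesic_ray_proj_ray:
  assumes "X.geodesic_ray \<rho>" "0 < speed \<rho>"
  shows "Y.geodesic_ray (proj_ray \<rho>)"
  unfolding Y.geodesic_ray_def
proof (intro conjI allI impI)
  show "proj_ray \<rho> \<in> {0..} \<rightarrow> Y"
    using assms by (auto simp: proj_ray_def X.geodesic_ray_def intro!: proj_in)
  fix s t :: real assume "0 \<le> s" "0 \<le> t"
  then have "e (proj_ray \<rho> s) (proj_ray \<rho> t) = \<bar>s / speed \<rho> - t / speed \<rho>\<bar> * speed \<rho>"
    using assms unfolding proj_ray_def by (intro dist_proj_along_ray) auto
  then show "e (proj_ray \<rho> s) (proj_ray \<rho> t) = \<bar>s - t\<bar>"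
    using assms(2) by (simp add: abs_divide flip: diff_divide_distrib)
qed

text \<open>A single \<tau> ends at the orbit point and passes through
  \<open>\<pi> (\<sigma> R)\<close>. Closeness known only at radius \<open>R\<close> in the product
  thus controls the factor geodesic that witnesses membership of the orbit point in a cone
  neighbourhood.\<close>

lemma proj_geodesic_to_orbit:
  assumes "g \<in> carrier G" "X.geodesic x\<^sub>0 (\<phi> g x\<^sub>0) \<sigma>" "0 < R" "R < d x\<^sub>0 (\<phi> g x\<^sub>0)"
  obtains \<tau> where "Y.geodesic y\<^sub>0 (\<psi> g y\<^sub>0) \<tau>" "Y.geodesic y\<^sub>0 (\<pi> (\<sigma> R)) \<tau>" "\<pi> (\<sigma> R) \<in> Y"
    "e y\<^sub>0 (\<pi> (\<sigma> R)) = R / d x\<^sub>0 (\<phi> g x\<^sub>0) * e y\<^sub>0 (\<psi> g y\<^sub>0)"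
    "e y\<^sub>0 (\<pi> (\<sigma> R)) \<le> e y\<^sub>0 (\<psi> g y\<^sub>0)"
proof -
  let ?l = "d x\<^sub>0 (\<phi> g x\<^sub>0)" and ?E = "e y\<^sub>0 (\<psi> g y\<^sub>0)"
  have ends: "\<sigma> 0 = x\<^sub>0" "\<sigma> ?l = \<phi> g x\<^sub>0"
    using assms(2) by (auto simp: X.geodesic_def)
  have in_Y: "\<pi> (\<sigma> (s * ?l)) \<in> Y" if "s \<in> {0..1}" for s
    using that by (intro proj_in X.geodesic_in_space[OF assms(2)]) (auto intro: mult_left_le_one_le)
  have "\<pi> (\<sigma> (0 * ?l)) = y\<^sub>0" "\<pi> (\<sigma> (1 * ?l)) = \<psi> g y\<^sub>0"
    using ends base orbit(2)[OF assms(1)] by simp_all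
  moreover have "e (\<pi> (\<sigma> (s * ?l))) (\<pi> (\<sigma> (t * ?l))) = \<bar>s - t\<bar> * ?E"
    if "s \<in> {0..1}" "t \<in> {0..1}" for s t
    using proj_affine[OF assms(2) that] base orbit(2)[OF assms(1)] by simp
  ultimately obtain \<tau> where \<tau>: "Y.geodesic y\<^sub>0 (\<psi> g y\<^sub>0) \<tau>"
      "\<And>a. a \<in> {0..1} \<Longrightarrow> \<tau> (a * ?E) = \<pi> (\<sigma> (a * ?l))"
    using in_Y by (rule_tac Y.affine_geodesic[of "\<lambda>a. \<pi> (\<sigma> (a * ?l))" y\<^sub>0 "\<psi> g y\<^sub>0"]) blast+
  have a: "R / ?l \<in> {0..1}" "R / ?l * ?l = R"
    using assms(3,4) by auto
  then have eq: "\<tau> (R / ?l * ?E) = \<pi> (\<sigma> R)"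
    using \<tau>(2)[OF a(1)] by simp
  have le: "0 \<le> R / ?l * ?E" "R / ?l * ?E \<le> ?E"
    using assms(3,4) mult_right_mono[of "R / ?l" 1 ?E] by simp_all
  have "Y.geodesic y\<^sub>0 (\<pi> (\<sigma> R)) \<tau>" "e y\<^sub>0 (\<pi> (\<sigma> R)) = R / ?l * ?E"
    using Y.geodesic_initial[OF \<tau>(1) le] Y.geodesic_dist_start[OF \<tau>(1) le] unfolding eq by simp_all
  moreover have "\<pi> (\<sigma> R) \<in> Y"
    using in_Y[OF a(1)] unfolding a(2) .
  ultimately show thesis
    using that \<tau>(1) le by simp
qed

text \<open>Some geodesic to an orbit point passes within 1 of \<open>\<rho> R\<close>. By
  \<open>orbit_expansion\<close> its projection has already moved by at least
  \<open>\<kappa> * R - \<bar>C\<bar>\<close> there, so the projected ray cannot have stayed at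
  \<open>y\<^sub>0\<close>.\<close>

lemma limset_speed_pos:
  assumes \<xi>: "\<xi> \<in> X.limset G \<phi> x\<^sub>0" and \<rho>: "\<rho> \<in> \<xi>" "\<rho> 0 = x\<^sub>0"
  shows "X.geodesic_ray \<rho>" "0 < speed \<rho>"
proof -
  have vb: "\<xi> \<in> X.visual_boundary"
    using \<xi> by (simp add: X.limset_def)
  show ray: "X.geodesic_ray \<rho>"
    using X.visual_boundary_class(1)[OF vb \<rho>(1)] .
  \<comment> \<open>This makes the guaranteed progress exactly 1, which the strict bound
    \<open>d (\<sigma> R) (\<rho> R) < 1\<close> cannot cancel.\<close>
  define R where "R = (\<bar>C\<bar> + 1) / \<kappa>"
  have R: "0 < R" "\<kappa> * R = \<bar>C\<bar> + 1"
    using scale_pos by (auto simp: R_def)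
  have "\<rho> R \<in> X"
    using ray R by (auto simp: X.geodesic_ray_def)
  then have "Inr \<xi> \<in> X.cone_nbhd \<rho> R 1"
    using vb \<rho> by (auto simp: X.Inr_in_cone_nbhd)
  moreover have "openin (X.cone_topology x\<^sub>0) (X.cone_nbhd \<rho> R 1)"
    using X.openin_cone_nbhd[OF ray R(1), of 1] \<rho> by simp
  ultimately obtain g where g: "g \<in> carrier G" and "Inl (\<phi> g x\<^sub>0) \<in> X.cone_nbhd \<rho> R 1"
    using X.limset_meets_orbit[OF \<xi>] by blast
  then obtain \<sigma> where far: "R < d x\<^sub>0 (\<phi> g x\<^sub>0)" and \<sigma>: "X.geodesic x\<^sub>0 (\<phi> g x\<^sub>0) \<sigma>"
    and close: "d (\<sigma> R) (\<rho> R) < 1"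
    using \<rho> by (auto simp: X.Inl_in_cone_nbhd)
  let ?l = "d x\<^sub>0 (\<phi> g x\<^sub>0)"
  have \<sigma>R: "\<sigma> R \<in> X"
    using X.geodesic_in_space[OF \<sigma>, of R] R far by simp
  obtain \<tau> where "Y.geodesic y\<^sub>0 (\<pi> (\<sigma> R)) \<tau>"
    and len: "e y\<^sub>0 (\<pi> (\<sigma> R)) = R / ?l * e y\<^sub>0 (\<psi> g y\<^sub>0)"
    using proj_geodesic_to_orbit[OF g \<sigma> R(1) far] by metis
  \<comment> \<open>Passing from the orbit point back to radius \<open>R\<close> scales the error
    \<open>C\<close> by \<open>R / ?l\<close>, which is below 1.\<close>
  have "\<bar>R / ?l\<bar> \<le> 1"
    using R far by simp
  then have "R / ?l * C \<le> \<bar>C\<bar>"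
    using mult_right_mono[of "\<bar>R / ?l\<bar>" 1 "\<bar>C\<bar>"] abs_ge_self[of "R / ?l * C"] by (simp add: abs_mult)
  then have "1 \<le> \<kappa> * R - R / ?l * C"
    using R by simp
  also have "\<kappa> * R - R / ?l * C = R / ?l * (\<kappa> * ?l - C)"
    using R(1) far by (simp add: right_diff_distrib mult.commute)
  also have "\<dots> \<le> e y\<^sub>0 (\<pi> (\<sigma> R))"
    unfolding len using orbit_expansion[OF g] R by (intro mult_left_mono) auto
  finally have "1 \<le> e y\<^sub>0 (\<pi> (\<sigma> R))" .
  moreover have "e (\<pi> (\<rho> R)) (\<pi> (\<sigma> R)) < 1"
    using proj_le[OF \<open>\<rho> R \<in> X\<close> \<sigma>R] close by (simp add: X.commute)
  moreover have "e y\<^sub>0 (\<pi> (\<sigma> R)) \<le> e y\<^sub>0 (\<pi> (\<rho> R)) + e (\<pi> (\<rho> R)) (\<pi> (\<sigma> R))"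
    using Y.triangle y0_in proj_in \<sigma>R \<open>\<rho> R \<in> X\<close> by blast
  moreover have "e y\<^sub>0 (\<pi> (\<rho> R)) = R * speed \<rho>"
    using dist_proj_along_ray[OF ray, of 0 R] R \<rho> base by simp
  ultimately have "0 < R * speed \<rho>"
    by linarith
  then show "0 < speed \<rho>"
    using R by (simp add: zero_less_mult_iff)
qed

lemma boundary_map_eq:
  assumes \<xi>: "\<xi> \<in> X.limset G \<phi> x\<^sub>0" and \<rho>: "\<rho> \<in> \<xi>" "\<rho> 0 = x\<^sub>0"
  shows "boundary_map \<xi> = Y.asymptotic `` {proj_ray \<rho>}"
proof -
  define \<rho>' where "\<rho>' = (SOME \<rho>. \<rho> \<in> \<xi> \<and> \<rho> 0 = x\<^sub>0)"
  have "\<rho>' \<in> \<xi> \<and> \<rho>' 0 = x\<^sub>0"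
    unfolding \<rho>'_def by (rule someI[of _ \<rho>]) (use \<rho> in simp)
  then have \<rho>': "\<rho>' \<in> \<xi>" "\<rho>' 0 = x\<^sub>0"
    by auto
  have "(\<rho>', \<rho>) \<in> X.asymptotic"
    using \<xi> \<rho> \<rho>' by (intro X.visual_boundary_asymptotic) (auto simp: X.limset_def)
  then have eq: "\<rho>' t = \<rho> t" if "0 \<le> t" for t
    using X.asymptotic_rays_eq that \<rho> \<rho>' by simp
  then have "proj_ray \<rho>' t = proj_ray \<rho> t" if "0 \<le> t" for t
    using that limset_speed_pos[OF \<xi> \<rho>] by (simp add: proj_ray_def speed_def)
  moreover have rays: "Y.geodesic_ray (proj_ray \<rho>')" "Y.geodesic_ray (proj_ray \<rho>)"
    using limset_speed_pos[OF \<xi> \<rho>] limset_speed_pos[OF \<xi> \<rho>'] by (auto intro: geodesic_ray_proj_ray)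
  moreover have "proj_ray \<rho> t \<in> Y" if "0 \<le> t" for t
    using rays(2) that by (auto simp: Y.geodesic_ray_def)
  ultimately have "(proj_ray \<rho>', proj_ray \<rho>) \<in> Y.asymptotic"
    by (auto simp: Y.asymptotic_def intro!: exI[of _ 0])
  then show ?thesis
    using equiv_class_eq[OF Y.equiv_asymptotic] by (simp add: boundary_map_def \<rho>'_def)
qed

text \<open>Orbit points and boundary points are treated together because a basic neighbourhood in
  the limit-set compactification contains both kinds.\<close>

lemma pullback_cone_nbhd:
  assumes \<xi>: "\<xi> \<in> X.limset G \<phi> x\<^sub>0" and \<rho>: "\<rho> \<in> \<xi>" "\<rho> 0 = x\<^sub>0"
    and c: "Y.geodesic_ray c" "c 0 = y\<^sub>0" and r: "0 < r" and \<epsilon>: "e (proj_ray \<rho> r) (c r) < \<epsilon>"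
  obtains R \<delta> where "0 < R" "0 < \<delta>"
    "\<And>g. g \<in> carrier G \<Longrightarrow> Inl (\<phi> g x\<^sub>0) \<in> X.cone_nbhd \<rho> R \<delta> \<Longrightarrow> Inl (\<psi> g y\<^sub>0) \<in> Y.cone_nbhd c r \<epsilon>"
    "\<And>\<eta>. \<eta> \<in> X.limset G \<phi> x\<^sub>0 \<Longrightarrow> Inr \<eta> \<in> X.cone_nbhd \<rho> R \<delta> \<Longrightarrow>
      Inr (boundary_map \<eta>) \<in> Y.cone_nbhd c r \<epsilon>"
proof -
  note ray = limset_speed_pos[OF \<xi> \<rho>]
  note pray = geodesic_ray_proj_ray[OF ray]
  \<comment> \<open>Half of the available slack, since \<open>geodesics_close\<close> doubles the
    distance of the end points.\<close>
  define \<delta> where "\<delta> = (\<epsilon> - e (proj_ray \<rho> r) (c r)) / 2"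
  \<comment> \<open>The projected ray is then at distance \<open>r + \<delta>\<close> from
    \<open>y\<^sub>0\<close>, so points within \<delta> of \<open>?v\<close> are still farther than
    \<open>r\<close> away.\<close>
  define R where "R = (r + \<delta>) / speed \<rho>"
  have \<delta>: "0 < \<delta>"
    using \<epsilon> by (simp add: \<delta>_def)
  have R: "0 < R" "speed \<rho> * R = r + \<delta>"
    using ray r \<delta> by (auto simp: R_def)
  let ?v = "\<pi> (\<rho> R)"
  have \<rho>R: "\<rho> R \<in> X"
    using ray R by (auto simp: X.geodesic_ray_def)
  have v: "?v \<in> Y"
    using proj_in[OF \<rho>R] .
  have gv: "Y.geodesic y\<^sub>0 ?v (proj_ray \<rho>)" and ev: "e y\<^sub>0 ?v = r + \<delta>"
    using Y.geodesic_ray_initial[OF pray, of "r + \<delta>"] proj_ray_scaled[OF ray(2), of R] R r \<delta> \<rho> base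
    by (auto simp: proj_ray_0)
  \<comment> \<open>Being within \<delta> of \<open>?v\<close> is enough for a geodesic from
    \<open>y\<^sub>0\<close> to satisfy both cone conditions. It is applied to the projections of
    \<open>\<sigma> R\<close> and of \<open>\<rho>' R\<close>.\<close>
  have key: "r < e y\<^sub>0 u" "e (\<tau> r) (c r) < \<epsilon>"
    if u: "Y.geodesic y\<^sub>0 u \<tau>" "u \<in> Y" "e u ?v < \<delta>" for u \<tau>
  proof -
    have "e y\<^sub>0 ?v \<le> e y\<^sub>0 u + e u ?v"
      using Y.triangle y0_in u v by blast
    then show ru: "r < e y\<^sub>0 u"
      using ev u by simp
    have "e (\<tau> r) (proj_ray \<rho> r) \<le> 2 * e u ?v"
      using u v y0_in gv ev r ru \<delta> by (intro Y.geodesics_close[of y\<^sub>0]) auto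
    moreover have "\<tau> r \<in> Y" "proj_ray \<rho> r \<in> Y" "c r \<in> Y"
      using Y.geodesic_in_space[OF u(1), of r] ru r pray c by (auto simp: Y.geodesic_ray_def)
    then have "e (\<tau> r) (c r) \<le> e (\<tau> r) (proj_ray \<rho> r) + e (proj_ray \<rho> r) (c r)"
      by (rule Y.triangle)
    ultimately show "e (\<tau> r) (c r) < \<epsilon>"
      using u(3) by (simp add: \<delta>_def)
  qed
  show thesis
  proof (rule that[OF R(1) \<delta>])
    fix g assume g: "g \<in> carrier G" and "Inl (\<phi> g x\<^sub>0) \<in> X.cone_nbhd \<rho> R \<delta>"
    then obtain \<sigma> where far: "R < d x\<^sub>0 (\<phi> g x\<^sub>0)" and \<sigma>: "X.geodesic x\<^sub>0 (\<phi> g x\<^sub>0) \<sigma>"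
      and close: "d (\<sigma> R) (\<rho> R) < \<delta>"
      using \<rho> by (auto simp: X.Inl_in_cone_nbhd)
    obtain \<tau> where \<tau>: "Y.geodesic y\<^sub>0 (\<psi> g y\<^sub>0) \<tau>" "Y.geodesic y\<^sub>0 (\<pi> (\<sigma> R)) \<tau>" "\<pi> (\<sigma> R) \<in> Y"
      "e y\<^sub>0 (\<pi> (\<sigma> R)) \<le> e y\<^sub>0 (\<psi> g y\<^sub>0)"
      using proj_geodesic_to_orbit[OF g \<sigma> R(1) far] by metis
    have "\<sigma> R \<in> X"
      using X.geodesic_in_space[OF \<sigma>, of R] R far by simp
    then have "e (\<pi> (\<sigma> R)) ?v < \<delta>"
      using proj_le[of "\<sigma> R" "\<rho> R"] \<rho>R close by simp
    note key[OF \<tau>(2,3) this]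
    moreover have "\<psi> g y\<^sub>0 \<in> Y"
      using orbit[OF g] proj_in by metis
    ultimately show "Inl (\<psi> g y\<^sub>0) \<in> Y.cone_nbhd c r \<epsilon>"
      using \<tau>(1,4) c(2) unfolding Y.Inl_in_cone_nbhd by (intro conjI exI[of _ \<tau>]) auto
  next
    fix \<eta> assume \<eta>: "\<eta> \<in> X.limset G \<phi> x\<^sub>0" and "Inr \<eta> \<in> X.cone_nbhd \<rho> R \<delta>"
    then obtain \<rho>' where \<rho>': "\<rho>' \<in> \<eta>" "\<rho>' 0 = x\<^sub>0" and close: "d (\<rho>' R) (\<rho> R) < \<delta>"
      using \<rho> by (auto simp: X.Inr_in_cone_nbhd)
    note ray' = limset_speed_pos[OF \<eta> \<rho>']
    note pray' = geodesic_ray_proj_ray[OF ray']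
    have \<rho>'R: "\<rho>' R \<in> X"
      using ray' R by (auto simp: X.geodesic_ray_def)
    have "Y.geodesic y\<^sub>0 (\<pi> (\<rho>' R)) (proj_ray \<rho>')"
      using Y.geodesic_ray_initial(1)[OF pray', of "speed \<rho>' * R"] proj_ray_scaled[OF ray'(2), of R]
        R ray' \<rho>' base by (simp add: proj_ray_0)
    moreover have "e (\<pi> (\<rho>' R)) ?v < \<delta>"
      using proj_le[OF \<rho>'R \<rho>R] close by simp
    ultimately have "e (proj_ray \<rho>' r) (c r) < \<epsilon>"
      using key(2) proj_in[OF \<rho>'R] by blast
    then show "Inr (boundary_map \<eta>) \<in> Y.cone_nbhd c r \<epsilon>"
      unfolding boundary_map_eq[OF \<eta> \<rho>'] Y.Inr_in_cone_nbhd
      using Y.asymptotic_class_in_visual_boundary[OF pray'] Y.geodesic_ray_in_own_class[OF pray']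
        \<rho>' base c(2) by (intro conjI bexI[of _ "proj_ray \<rho>'"]) (auto simp: proj_ray_0)
  qed
qed

text \<open>The property passes to finite intersections and unions, so subbasic sets suffice. Metric
  balls contain no boundary points, which leaves cone neighbourhoods.\<close>

lemma pullback_open:
  assumes "openin (Y.cone_topology y\<^sub>0) U" "\<xi> \<in> X.limset G \<phi> x\<^sub>0" "Inr (boundary_map \<xi>) \<in> U"
  shows "\<exists>W. openin (X.cone_topology x\<^sub>0) W \<and> Inr \<xi> \<in> W \<and>
    (\<forall>g\<in>carrier G. Inl (\<phi> g x\<^sub>0) \<in> W \<longrightarrow> Inl (\<psi> g y\<^sub>0) \<in> U) \<and>
    (\<forall>\<eta>\<in>X.limset G \<phi> x\<^sub>0. Inr \<eta> \<in> W \<longrightarrow> Inr (boundary_map \<eta>) \<in> U)"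
  using assms(1)[unfolded Y.cone_topology_def openin_topology_generated_by_iff] assms(3)
proof (induction rule: generate_topology_on.induct)
  case Empty
  then show ?case by simp
next
  case (Int a b)
  then obtain V W where
    "openin (X.cone_topology x\<^sub>0) V \<and> Inr \<xi> \<in> V \<and>
      (\<forall>g\<in>carrier G. Inl (\<phi> g x\<^sub>0) \<in> V \<longrightarrow> Inl (\<psi> g y\<^sub>0) \<in> a) \<and>
      (\<forall>\<eta>\<in>X.limset G \<phi> x\<^sub>0. Inr \<eta> \<in> V \<longrightarrow> Inr (boundary_map \<eta>) \<in> a)"
    "openin (X.cone_topology x\<^sub>0) W \<and> Inr \<xi> \<in> W \<and>
      (\<forall>g\<in>carrier G. Inl (\<phi> g x\<^sub>0) \<in> W \<longrightarrow> Inl (\<psi> g y\<^sub>0) \<in> b) \<and>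
      (\<forall>\<eta>\<in>X.limset G \<phi> x\<^sub>0. Inr \<eta> \<in> W \<longrightarrow> Inr (boundary_map \<eta>) \<in> b)"
    by blast
  then show ?case
    by (intro exI[of _ "V \<inter> W"]) auto
next
  case (UN K)
  then obtain k where "k \<in> K" "Inr (boundary_map \<xi>) \<in> k"
    by blast
  with UN.IH[OF this] show ?case
    by blast
next
  case (Basis U)
  from Basis.hyps consider x r where "U = Inl ` Y.mball x r"
    | c r \<epsilon> where "U = Y.cone_nbhd c r \<epsilon>" "Y.geodesic_ray c" "c 0 = y\<^sub>0" "0 < r" "0 < \<epsilon>"
    by blast
  then show ?case
  proof cases
    case 1
    then show ?thesis
      using Basis.prems by auto
  next
    case 2
    obtain \<rho> where \<rho>: "\<rho> \<in> \<xi>" "\<rho> 0 = x\<^sub>0"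
      using X.limset_ray[OF assms(2)] .
    note ray = limset_speed_pos[OF assms(2) \<rho>]
    note pray = geodesic_ray_proj_ray[OF ray]
    \<comment> \<open>The centre \<open>c\<close> need not represent
      \<open>boundary_map \<xi>\<close>. Membership provides a ray of the class starting at
      \<open>y\<^sub>0\<close>, which coincides with \<open>proj_ray \<rho>\<close> at nonnegative
      times.\<close>
    obtain \<tau> where \<tau>: "\<tau> \<in> Y.asymptotic `` {proj_ray \<rho>}" "\<tau> 0 = y\<^sub>0" "e (\<tau> r) (c r) < \<epsilon>"
      using Basis.prems 2 unfolding boundary_map_eq[OF assms(2) \<rho>] by (auto simp: Y.Inr_in_cone_nbhd)
    have "proj_ray \<rho> r = \<tau> r"
      using Y.asymptotic_rays_eq[of "proj_ray \<rho>" \<tau> r] \<tau> 2 \<rho> base by (simp add: proj_ray_0)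
    then have "e (proj_ray \<rho> r) (c r) < \<epsilon>"
      using \<tau> by simp
    then obtain R \<delta> where R: "0 < R" "0 < \<delta>"
      and *: "\<And>g. g \<in> carrier G \<Longrightarrow> Inl (\<phi> g x\<^sub>0) \<in> X.cone_nbhd \<rho> R \<delta> \<Longrightarrow> Inl (\<psi> g y\<^sub>0) \<in> U"
        "\<And>\<eta>. \<eta> \<in> X.limset G \<phi> x\<^sub>0 \<Longrightarrow> Inr \<eta> \<in> X.cone_nbhd \<rho> R \<delta> \<Longrightarrow> Inr (boundary_map \<eta>) \<in> U"
      using pullback_cone_nbhd[OF assms(2) \<rho> 2(2,3,4)] unfolding 2(1) by blast
    have "openin (X.cone_topology x\<^sub>0) (X.cone_nbhd \<rho> R \<delta>)"
      using X.openin_cone_nbhd[OF ray(1) R] \<rho> by simp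
    moreover have "\<rho> R \<in> X"
      using ray R by (auto simp: X.geodesic_ray_def)
    then have "Inr \<xi> \<in> X.cone_nbhd \<rho> R \<delta>"
      using assms(2) \<rho> R by (auto simp: X.Inr_in_cone_nbhd X.limset_def)
    ultimately show ?thesis
      using * by blast
  qed
qed

text \<open>A neighbourhood of the image pulls back to one of \<xi>. The latter contains an orbit
  point, and the same group element gives an orbit point in the former.\<close>

lemma boundary_map_in_limset:
  assumes "\<xi> \<in> X.limset G \<phi> x\<^sub>0"
  shows "boundary_map \<xi> \<in> Y.limset G \<psi> y\<^sub>0"
proof -
  obtain \<rho> where \<rho>: "\<rho> \<in> \<xi>" "\<rho> 0 = x\<^sub>0"
    using X.limset_ray[OF assms] .
  note pray = geodesic_ray_proj_ray[OF limset_speed_pos[OF assms \<rho>]]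
  have vb: "boundary_map \<xi> \<in> Y.visual_boundary"
    unfolding boundary_map_eq[OF assms \<rho>] by (rule Y.asymptotic_class_in_visual_boundary[OF pray])
  have "proj_ray \<rho> 1 \<in> Y"
    using pray by (auto simp: Y.geodesic_ray_def)
  \<comment> \<open>Closure points must belong to the topspace; any cone neighbourhood centred at
    the ray itself shows this, here with radius and width 1.\<close>
  then have "Inr (boundary_map \<xi>) \<in> Y.cone_nbhd (proj_ray \<rho>) 1 1"
    using vb Y.geodesic_ray_in_own_class[OF pray] unfolding Y.Inr_in_cone_nbhd boundary_map_eq[OF assms \<rho>]
    by (intro conjI bexI[of _ "proj_ray \<rho>"]) auto
  moreover have "openin (Y.cone_topology y\<^sub>0) (Y.cone_nbhd (proj_ray \<rho>) 1 1)"
    using Y.openin_cone_nbhd[OF pray, of 1 1] \<rho> base by (simp add: proj_ray_0)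
  ultimately have "Inr (boundary_map \<xi>) \<in> topspace (Y.cone_topology y\<^sub>0)"
    using openin_subset by blast
  moreover have "\<exists>z. z \<in> Inl ` orbit G \<psi> y\<^sub>0 \<and> z \<in> U"
    if U: "Inr (boundary_map \<xi>) \<in> U" "openin (Y.cone_topology y\<^sub>0) U" for U
  proof -
    obtain W where W: "openin (X.cone_topology x\<^sub>0) W" "Inr \<xi> \<in> W"
      "\<forall>g\<in>carrier G. Inl (\<phi> g x\<^sub>0) \<in> W \<longrightarrow> Inl (\<psi> g y\<^sub>0) \<in> U"
      using pullback_open[OF U(2) assms U(1)] by blast
    obtain g where "g \<in> carrier G" "Inl (\<phi> g x\<^sub>0) \<in> W"
      by (rule X.limset_meets_orbit[OF assms W(1,2)])
    then show ?thesis
      using W(3) by (intro exI[of _ "Inl (\<psi> g y\<^sub>0)"]) (auto simp: orbit_def)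
  qed
  ultimately show ?thesis
    using vb by (simp add: Y.limset_def in_closure_of)
qed

theorem limset_map_boundary_map: "limset_map G X d \<phi> x\<^sub>0 Y e \<psi> y\<^sub>0 boundary_map"
proof -
  let ?TX = "X.limset_compactification G \<phi> x\<^sub>0"
  let ?LX = "X.limset G \<phi> x\<^sub>0" and ?LY = "Y.limset G \<psi> y\<^sub>0"
  define F :: "'g + (real \<Rightarrow> 'a) set \<Rightarrow> 'g + (real \<Rightarrow> 'b) set"
    where "F = map_sum id boundary_map"
  have F: "F (Inl g) = Inl g" "F (Inr \<xi>) = Inr (boundary_map \<xi>)" for g \<xi>
    by (simp_all add: F_def)
  have points: "openin ?TX {Inl g}" if "g \<in> carrier G" for g
    using that by (rule X.openin_limset_compactification_point)
  have traces: "openin ?TX (F -` (Inl ` {g \<in> carrier G. Inl (\<psi> g y\<^sub>0) \<in> U} \<union> Inr ` {\<xi> \<in> ?LY. Inr \<xi> \<in> U})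
      \<inter> topspace ?TX)" (is "openin ?TX ?P")
    if U: "openin (Y.cone_topology y\<^sub>0) U" for U
  \<comment> \<open>Openness is checked pointwise: group elements are isolated, and at limit points
    \<open>pullback_open\<close> provides a basic neighbourhood.\<close>
  proof (subst openin_subopen, intro ballI)
    fix z assume z: "z \<in> ?P"
    then consider g where "z = Inl g" "g \<in> carrier G" | \<xi> where "z = Inr \<xi>" "\<xi> \<in> ?LX"
      unfolding X.topspace_limset_compactification by blast
    then show "\<exists>T. openin ?TX T \<and> z \<in> T \<and> T \<subseteq> ?P"
    proof cases
      case 1
      then show ?thesis
        using z points by (intro exI[of _ "{z}"]) simp
    next
      case 2
      then have "Inr (boundary_map \<xi>) \<in> U"
        using z by (auto simp: F)
      then obtain W where W: "openin (X.cone_topology x\<^sub>0) W" "Inr \<xi> \<in> W"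
        "\<forall>g\<in>carrier G. Inl (\<phi> g x\<^sub>0) \<in> W \<longrightarrow> Inl (\<psi> g y\<^sub>0) \<in> U"
        "\<forall>\<eta>\<in>?LX. Inr \<eta> \<in> W \<longrightarrow> Inr (boundary_map \<eta>) \<in> U"
        using pullback_open[OF U 2(2)] by blast
      let ?T = "Inl ` {g \<in> carrier G. Inl (\<phi> g x\<^sub>0) \<in> W} \<union> Inr ` {\<xi> \<in> ?LX. Inr \<xi> \<in> W}"
      have "?T \<subseteq> ?P"
        using W(3,4) boundary_map_in_limset by (auto simp: F X.topspace_limset_compactification)
      moreover have "z \<in> ?T"
        using 2 W(2) by simp
      ultimately show ?thesis
        using X.openin_limset_compactification_trace[OF W(1), of G \<phi>] by blast
    qed
  qed
  have "continuous_map ?TX (Y.limset_compactification G \<psi> y\<^sub>0) F"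
    unfolding Y.limset_compactification_def
  proof (rule continuous_on_generated_topo)
    fix V assume "V \<in> {{Inl g} |g. g \<in> carrier G} \<union>
      {Inl ` {g \<in> carrier G. Inl (\<psi> g y\<^sub>0) \<in> U} \<union> Inr ` {\<xi> \<in> ?LY. Inr \<xi> \<in> U} |U.
        openin (Y.cone_topology y\<^sub>0) U}"
    then consider g where "V = {Inl g}" "g \<in> carrier G"
      | U where "V = Inl ` {g \<in> carrier G. Inl (\<psi> g y\<^sub>0) \<in> U} \<union> Inr ` {\<xi> \<in> ?LY. Inr \<xi> \<in> U}"
        "openin (Y.cone_topology y\<^sub>0) U"
      by blast
    then show "openin ?TX (F -` V \<inter> topspace ?TX)"
    proof cases
      case 1
      then have "F -` V \<inter> topspace ?TX = {Inl g}"
        by (auto simp: F X.topspace_limset_compactification)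
      then show ?thesis
        using points[OF 1(2)] by simp
    next
      case 2
      then show ?thesis
        using traces by simp
    qed
  next
    have "F ` topspace ?TX \<subseteq> topspace (Y.limset_compactification G \<psi> y\<^sub>0)"
      unfolding X.topspace_limset_compactification Y.topspace_limset_compactification
      using boundary_map_in_limset by (auto simp: F)
    then show "F ` topspace ?TX \<subseteq> \<Union> ({{Inl g} |g. g \<in> carrier G} \<union>
      {Inl ` {g \<in> carrier G. Inl (\<psi> g y\<^sub>0) \<in> U} \<union> Inr ` {\<xi> \<in> ?LY. Inr \<xi> \<in> U} |U.
        openin (Y.cone_topology y\<^sub>0) U})"
      by (simp only: Y.limset_compactification_def topology_generated_by_topspace)
  qed
  then show ?thesis
    unfolding limset_map_def using boundary_map_in_limset F by auto
qed

end


section \<open>The diagonal action\<close>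

lemma (in isometric_action) action_in: "g \<in> carrier G \<Longrightarrow> x \<in> M \<Longrightarrow> \<phi> g x \<in> M"
  by (rule element_image[OF _ _ refl])

lemma (in isometric_action) action_one: "x \<in> M \<Longrightarrow> \<phi> \<one> x = x"
  using fun_cong[OF id_eq_one, of x] by simp

text \<open>The restriction to \<open>M1 \<times> M2\<close> is forced by
  \<open>group_action\<close>: the elements of \<open>BijGroup\<close> are extensional
  functions.\<close>

definition product_action ::
  "'a set \<Rightarrow> 'b set \<Rightarrow> ('g \<Rightarrow> 'a \<Rightarrow> 'a) \<Rightarrow> ('g \<Rightarrow> 'b \<Rightarrow> 'b) \<Rightarrow> 'g \<Rightarrow> 'a \<times> 'b \<Rightarrow> 'a \<times> 'b" where
  "product_action M1 M2 \<phi>1 \<phi>2 g = (\<lambda>p\<in>M1 \<times> M2. (\<phi>1 g (fst p), \<phi>2 g (snd p)))"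

lemma product_action_apply:
  "x \<in> M1 \<Longrightarrow> y \<in> M2 \<Longrightarrow> product_action M1 M2 \<phi>1 \<phi>2 g (x, y) = (\<phi>1 g x, \<phi>2 g y)"
  by (simp add: product_action_def)

lemma product_group_action:
  assumes "group_action G M1 \<phi>1" "group_action G M2 \<phi>2"
  shows "group_action G (M1 \<times> M2) (product_action M1 M2 \<phi>1 \<phi>2)"
proof -
  interpret A1: group_action G M1 \<phi>1 by fact
  interpret A2: group_action G M2 \<phi>2 by fact
  have G: "group G"
    using A1.group_hom by (simp add: group_hom_def)
  have in_M: "\<phi>1 g x \<in> M1" "\<phi>2 g y \<in> M2" if "g \<in> carrier G" "x \<in> M1" "y \<in> M2" for g x y
    using A1.element_image A2.element_image that by blast+
  let ?\<Phi> = "product_action M1 M2 \<phi>1 \<phi>2"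
  have Bij: "?\<Phi> g \<in> Bij (M1 \<times> M2)" if g: "g \<in> carrier G" for g
  proof -
    have "bij_betw (map_prod (\<phi>1 g) (\<phi>2 g)) (M1 \<times> M2) (M1 \<times> M2)"
      using A1.bij_prop0[OF g] A2.bij_prop0[OF g] by (intro bij_betw_map_prod) (auto simp: Bij_def)
    then have "bij_betw (?\<Phi> g) (M1 \<times> M2) (M1 \<times> M2)"
      by (rule bij_betw_cong[THEN iffD1, rotated]) (auto simp: product_action_def)
    then show ?thesis
      by (simp add: Bij_def product_action_def)
  qed
  have "?\<Phi> (g \<otimes>\<^bsub>G\<^esub> h) = compose (M1 \<times> M2) (?\<Phi> g) (?\<Phi> h)"
    if "g \<in> carrier G" "h \<in> carrier G" for g h
  proof
    fix p
    show "?\<Phi> (g \<otimes>\<^bsub>G\<^esub> h) p = compose (M1 \<times> M2) (?\<Phi> g) (?\<Phi> h) p"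
    proof (cases "p \<in> M1 \<times> M2")
      case True
      then have "\<phi>1 h (fst p) \<in> M1" "\<phi>2 h (snd p) \<in> M2"
        using in_M[OF that(2), of "fst p" "snd p"] by (auto simp: mem_Times_iff)
      then show ?thesis
        using that True A1.composition_rule[of "fst p" g h] A2.composition_rule[of "snd p" g h]
        by (simp add: product_action_def compose_def mem_Times_iff)
    qed (simp add: product_action_def compose_def)
  qed
  then have "?\<Phi> \<in> hom G (BijGroup (M1 \<times> M2))"
    using Bij by (auto simp: hom_def BijGroup_def)
  then show ?thesis
    using G group_BijGroup by (simp add: group_action_def group_hom_def group_hom_axioms_def)
qed

lemma product_isometric_action:
  assumes "isometric_action G M1 d1 \<phi>1" "isometric_action G M2 d2 \<phi>2"
  shows "isometric_action G (M1 \<times> M2) (prod_dist d1 d2) (product_action M1 M2 \<phi>1 \<phi>2)"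
proof -
  interpret A1: isometric_action G M1 d1 \<phi>1 by fact
  interpret A2: isometric_action G M2 d2 \<phi>2 by fact
  interpret Metric_space12 M1 d1 M2 d2 ..
  interpret group_action G "M1 \<times> M2" "product_action M1 M2 \<phi>1 \<phi>2"
    by (rule product_group_action[OF A1.group_action_axioms A2.group_action_axioms])
  show ?thesis
  proof
    fix g p q assume "g \<in> carrier G" "p \<in> M1 \<times> M2" "q \<in> M1 \<times> M2"
    then show "prod_dist d1 d2 (product_action M1 M2 \<phi>1 \<phi>2 g p) (product_action M1 M2 \<phi>1 \<phi>2 g q) =
        prod_dist d1 d2 p q"
      by (auto simp: product_action_apply prod_dist_def A1.isometry A2.isometry)
  qed
qed

text \<open>Product displacement is monotone in the two factor displacements, so a pair of
  minimisers is a minimiser.\<close>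

lemma product_semi_simple:
  assumes "isometric_action G M1 d1 \<phi>1" "isometric_action G M2 d2 \<phi>2"
    and "Metric_space.semi_simple M1 d1 (\<phi>1 g)" "Metric_space.semi_simple M2 d2 (\<phi>2 g)"
  shows "Metric_space.semi_simple (M1 \<times> M2) (prod_dist d1 d2) (product_action M1 M2 \<phi>1 \<phi>2 g)"
proof -
  interpret A1: isometric_action G M1 d1 \<phi>1 by fact
  interpret A2: isometric_action G M2 d2 \<phi>2 by fact
  interpret Metric_space12 M1 d1 M2 d2 ..
  obtain x y where xy: "x \<in> M1" "y \<in> M2"
    and x: "\<And>x'. x' \<in> M1 \<Longrightarrow> d1 x (\<phi>1 g x) \<le> d1 x' (\<phi>1 g x')"
    and y: "\<And>y'. y' \<in> M2 \<Longrightarrow> d2 y (\<phi>2 g y) \<le> d2 y' (\<phi>2 g y')"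
    using assms(3,4) unfolding A1.semi_simple_iff A2.semi_simple_iff by blast
  have "prod_dist d1 d2 (x, y) (product_action M1 M2 \<phi>1 \<phi>2 g (x, y)) \<le>
      prod_dist d1 d2 (x', y') (product_action M1 M2 \<phi>1 \<phi>2 g (x', y'))" if "x' \<in> M1" "y' \<in> M2" for x' y'
    using that xy x y by (auto simp: product_action_apply prod_dist_def intro!: add_mono power_mono)
  then show ?thesis
    using xy unfolding Prod_metric.semi_simple_iff by (intro bexI[of _ "(x, y)"]) auto
qed

text \<open>The product distance lies between the first component distance and the sum of both, so
  the lower bound of \<open>f1\<close> and the sum of the upper bounds survive.\<close>

lemma quasi_isometric_embedding_product:
  assumes "Metric_space M1 d1" "Metric_space M2 d2" and w: "\<And>a a'. 0 \<le> w a a'"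
    and "quasi_isometric_embedding A w M1 d1 f1" "quasi_isometric_embedding A w M2 d2 f2"
  shows "quasi_isometric_embedding A w (M1 \<times> M2) (prod_dist d1 d2) (\<lambda>a. (f1 a, f2 a))"
proof -
  interpret M1: Metric_space M1 d1 by fact
  interpret M2: Metric_space M2 d2 by fact
  interpret Metric_space12 M1 d1 M2 d2 ..
  obtain L1 \<epsilon>1 where 1: "f1 \<in> A \<rightarrow> M1" "0 < L1" "0 < \<epsilon>1"
    "\<And>a a'. a \<in> A \<Longrightarrow> a' \<in> A \<Longrightarrow> 1 / L1 * w a a' - \<epsilon>1 \<le> d1 (f1 a) (f1 a') \<and> d1 (f1 a) (f1 a') \<le> L1 * w a a' + \<epsilon>1"
    using assms(4) unfolding quasi_isometric_embedding_def by metis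
  obtain L2 \<epsilon>2 where 2: "f2 \<in> A \<rightarrow> M2" "0 < L2" "0 < \<epsilon>2"
    "\<And>a a'. a \<in> A \<Longrightarrow> a' \<in> A \<Longrightarrow> 1 / L2 * w a a' - \<epsilon>2 \<le> d2 (f2 a) (f2 a') \<and> d2 (f2 a) (f2 a') \<le> L2 * w a a' + \<epsilon>2"
    using assms(5) unfolding quasi_isometric_embedding_def by metis
  have "1 / (L1 + L2) * w a a' - (\<epsilon>1 + \<epsilon>2) \<le> prod_dist d1 d2 (f1 a, f2 a) (f1 a', f2 a')"
    "prod_dist d1 d2 (f1 a, f2 a) (f1 a', f2 a') \<le> (L1 + L2) * w a a' + (\<epsilon>1 + \<epsilon>2)"
    if a: "a \<in> A" "a' \<in> A" for a a'
  proof -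
    have M: "f1 a \<in> M1" "f1 a' \<in> M1" "f2 a \<in> M2" "f2 a' \<in> M2"
      using 1(1) 2(1) a by auto
    have "1 / (L1 + L2) * w a a' \<le> 1 / L1 * w a a'"
      using 1(2) 2(2) w by (intro mult_right_mono divide_left_mono) auto
    moreover have "d1 (f1 a) (f1 a') \<le> prod_dist d1 d2 (f1 a, f2 a) (f1 a', f2 a')"
      by (rule component_le_prod_metric)
    ultimately show "1 / (L1 + L2) * w a a' - (\<epsilon>1 + \<epsilon>2) \<le> prod_dist d1 d2 (f1 a, f2 a) (f1 a', f2 a')"
      using 1(4)[OF a] 2(3) by linarith
    show "prod_dist d1 d2 (f1 a, f2 a) (f1 a', f2 a') \<le> (L1 + L2) * w a a' + (\<epsilon>1 + \<epsilon>2)"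
      using prod_metric_le_components[OF M] 1(4)[OF a] 2(4)[OF a] by (simp add: distrib_right)
  qed
  moreover have "(\<lambda>a. (f1 a, f2 a)) \<in> A \<rightarrow> M1 \<times> M2"
    using 1(1) 2(1) by auto
  moreover have "0 < L1 + L2" "0 < \<epsilon>1 + \<epsilon>2"
    using 1 2 by auto
  ultimately show ?thesis
    unfolding quasi_isometric_embedding_def by blast
qed

text \<open>Eliminating \<open>w b a\<close> between the lower bound for \<open>d1\<close> and the
  upper bound for \<open>d2\<close> gives
  \<open>d2 \<le> L1 * L2 * (d1 + \<epsilon>1) + \<epsilon>2\<close>; adding \<open>d1\<close>
  explains \<open>K\<close>. The bound involves the sum \<open>d1 + d2\<close> because that sum
  dominates the product distance.\<close>

lemma quasi_isometric_embeddings_comparable: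
  assumes "quasi_isometric_embedding A w M1 d1 f1" "quasi_isometric_embedding A w M2 d2 f2" "b \<in> A"
  obtains \<kappa> C :: real where "0 < \<kappa>"
    "\<And>a. a \<in> A \<Longrightarrow> \<kappa> * (d1 (f1 b) (f1 a) + d2 (f2 b) (f2 a)) - C \<le> d1 (f1 b) (f1 a)"
proof -
  obtain L1 \<epsilon>1 where 1: "0 < L1"
    "\<And>a. a \<in> A \<Longrightarrow> 1 / L1 * w b a - \<epsilon>1 \<le> d1 (f1 b) (f1 a)"
    using assms(1,3) unfolding quasi_isometric_embedding_def by metis
  obtain L2 \<epsilon>2 where 2: "0 < L2"
    "\<And>a. a \<in> A \<Longrightarrow> d2 (f2 b) (f2 a) \<le> L2 * w b a + \<epsilon>2"
    using assms(2,3) unfolding quasi_isometric_embedding_def by metis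
  define K where "K = 1 + L1 * L2"
  have K: "0 < K"
    using 1 2 by (simp add: K_def add_pos_pos)
  show thesis
  proof (rule that[of "1 / K" "(L1 * L2 * \<epsilon>1 + \<epsilon>2) / K"])
    fix a assume a: "a \<in> A"
    have "w b a \<le> L1 * (d1 (f1 b) (f1 a) + \<epsilon>1)"
      using 1(2)[OF a] 1(1) by (simp add: field_simps)
    then have "L2 * w b a \<le> L2 * (L1 * (d1 (f1 b) (f1 a) + \<epsilon>1))"
      using 2(1) by (intro mult_left_mono) auto
    then have "d1 (f1 b) (f1 a) + d2 (f2 b) (f2 a) - (L1 * L2 * \<epsilon>1 + \<epsilon>2) \<le> K * d1 (f1 b) (f1 a)"
      using 2(2)[OF a] by (simp add: K_def algebra_simps)
    then have "(d1 (f1 b) (f1 a) + d2 (f2 b) (f2 a) - (L1 * L2 * \<epsilon>1 + \<epsilon>2)) / K \<le> d1 (f1 b) (f1 a)"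
      using K by (simp add: pos_divide_le_eq mult.commute)
    then show "1 / K * (d1 (f1 b) (f1 a) + d2 (f2 b) (f2 a)) - (L1 * L2 * \<epsilon>1 + \<epsilon>2) / K \<le> d1 (f1 b) (f1 a)"
      by (simp add: diff_divide_distrib)
  qed (use K in simp)
qed

theorem theorem1:
  fixes G :: "('g, 'm) monoid_scheme" and S :: "'g set"
    and X\<^sub>1 :: "'a set" and d\<^sub>1 :: "'a \<Rightarrow> 'a \<Rightarrow> real" and \<phi>\<^sub>1 :: "'g \<Rightarrow> 'a \<Rightarrow> 'a" and x\<^sub>1 :: 'a
    and X\<^sub>2 :: "'b set" and d\<^sub>2 :: "'b \<Rightarrow> 'b \<Rightarrow> real" and \<phi>\<^sub>2 :: "'g \<Rightarrow> 'b \<Rightarrow> 'b" and x\<^sub>2 :: 'b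
  assumes "group G" and "infinite (carrier G)"
    and "finite S" and "S \<subseteq> carrier G" and "generate G S = carrier G"
    and "proper_CAT0_space X\<^sub>1 d\<^sub>1" and "isometric_action G X\<^sub>1 d\<^sub>1 \<phi>\<^sub>1" and "x\<^sub>1 \<in> X\<^sub>1"
    and "proper_CAT0_space X\<^sub>2 d\<^sub>2" and "isometric_action G X\<^sub>2 d\<^sub>2 \<phi>\<^sub>2" and "x\<^sub>2 \<in> X\<^sub>2"
    and "quasi_isometric_embedding (carrier G) (word_dist G S) X\<^sub>1 d\<^sub>1 (\<lambda>g. \<phi>\<^sub>1 g x\<^sub>1)"
    and "quasi_isometric_embedding (carrier G) (word_dist G S) X\<^sub>2 d\<^sub>2 (\<lambda>g. \<phi>\<^sub>2 g x\<^sub>2)"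
  shows "\<exists>(X :: ('a \<times> 'b) set) d \<phi> x\<^sub>0.
           proper_CAT0_space X d \<and> isometric_action G X d \<phi> \<and> x\<^sub>0 \<in> X \<and>
           quasi_isometric_embedding (carrier G) (word_dist G S) X d (\<lambda>g. \<phi> g x\<^sub>0) \<and>
           (\<exists>f\<^sub>1. limset_map G X d \<phi> x\<^sub>0 X\<^sub>1 d\<^sub>1 \<phi>\<^sub>1 x\<^sub>1 f\<^sub>1) \<and>
           (\<exists>f\<^sub>2. limset_map G X d \<phi> x\<^sub>0 X\<^sub>2 d\<^sub>2 \<phi>\<^sub>2 x\<^sub>2 f\<^sub>2) \<and>
           ((\<forall>g\<in>carrier G. Metric_space.semi_simple X\<^sub>1 d\<^sub>1 (\<phi>\<^sub>1 g)) \<and>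
            (\<forall>g\<in>carrier G. Metric_space.semi_simple X\<^sub>2 d\<^sub>2 (\<phi>\<^sub>2 g)) \<longrightarrow>
            (\<forall>g\<in>carrier G. Metric_space.semi_simple X d (\<phi> g)))"
proof -
  interpret G: group G by fact
  interpret C1: proper_CAT0_space X\<^sub>1 d\<^sub>1 by fact
  interpret C2: proper_CAT0_space X\<^sub>2 d\<^sub>2 by fact
  interpret A1: isometric_action G X\<^sub>1 d\<^sub>1 \<phi>\<^sub>1 by fact
  interpret A2: isometric_action G X\<^sub>2 d\<^sub>2 \<phi>\<^sub>2 by fact
  interpret P: CAT0_space12 X\<^sub>1 d\<^sub>1 X\<^sub>2 d\<^sub>2 ..
  let ?X = "X\<^sub>1 \<times> X\<^sub>2" and ?d = "prod_dist d\<^sub>1 d\<^sub>2" and ?\<phi> = "product_action X\<^sub>1 X\<^sub>2 \<phi>\<^sub>1 \<phi>\<^sub>2"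
  interpret PC: CAT0_space ?X ?d by (rule P.product_CAT0)
  note qie = assms(12,13)
  have act: "?\<phi> g (x\<^sub>1, x\<^sub>2) = (\<phi>\<^sub>1 g x\<^sub>1, \<phi>\<^sub>2 g x\<^sub>2)" for g
    using assms(8,11) by (rule product_action_apply)
  have orb: "\<phi>\<^sub>1 g x\<^sub>1 \<in> X\<^sub>1" "\<phi>\<^sub>2 g x\<^sub>2 \<in> X\<^sub>2" if "g \<in> carrier G" for g
    using that assms(8,11) by (auto intro: A1.action_in A2.action_in)
  have one: "\<phi>\<^sub>1 \<one>\<^bsub>G\<^esub> x\<^sub>1 = x\<^sub>1" "\<phi>\<^sub>2 \<one>\<^bsub>G\<^esub> x\<^sub>2 = x\<^sub>2"
    using assms(8,11) by (simp_all add: A1.action_one A2.action_one)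
  have le: "?d (x\<^sub>1, x\<^sub>2) (?\<phi> g (x\<^sub>1, x\<^sub>2)) \<le> d\<^sub>1 x\<^sub>1 (\<phi>\<^sub>1 g x\<^sub>1) + d\<^sub>2 x\<^sub>2 (\<phi>\<^sub>2 g x\<^sub>2)" if "g \<in> carrier G" for g
    unfolding act by (intro P.prod_metric_le_components assms(8,11) orb that)
  have qie_X: "quasi_isometric_embedding (carrier G) (word_dist G S) ?X ?d (\<lambda>g. ?\<phi> g (x\<^sub>1, x\<^sub>2))"
    unfolding act using qie
    by (intro quasi_isometric_embedding_product C1.Metric_space_axioms C2.Metric_space_axioms)
      (simp_all add: word_dist_def)
  have map1: "\<exists>f. limset_map G ?X ?d ?\<phi> (x\<^sub>1, x\<^sub>2) X\<^sub>1 d\<^sub>1 \<phi>\<^sub>1 x\<^sub>1 f"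
  proof -
    \<comment> \<open>Comparison based at the identity, whose orbit points are
      \<open>x\<^sub>1\<close> and \<open>x\<^sub>2\<close>, speaks of displacements of the base
      points, as \<open>orbit_expansion\<close> demands.\<close>
    obtain \<kappa> C where \<kappa>: "0 < \<kappa>" and C: "\<And>g. g \<in> carrier G \<Longrightarrow>
        \<kappa> * (d\<^sub>1 x\<^sub>1 (\<phi>\<^sub>1 g x\<^sub>1) + d\<^sub>2 x\<^sub>2 (\<phi>\<^sub>2 g x\<^sub>2)) - C \<le> d\<^sub>1 x\<^sub>1 (\<phi>\<^sub>1 g x\<^sub>1)"
      by (rule quasi_isometric_embeddings_comparable[OF qie G.one_closed, unfolded one]) blast
    have exp: "\<kappa> * ?d (x\<^sub>1, x\<^sub>2) (?\<phi> g (x\<^sub>1, x\<^sub>2)) - C \<le> d\<^sub>1 x\<^sub>1 (\<phi>\<^sub>1 g x\<^sub>1)" if "g \<in> carrier G" for g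
      using C[OF that] mult_left_mono[OF le[OF that], of \<kappa>] \<kappa> by linarith
    interpret equivariant_projection ?X ?d X\<^sub>1 d\<^sub>1 G ?\<phi> \<phi>\<^sub>1 fst "(x\<^sub>1, x\<^sub>2)" x\<^sub>1 \<kappa> C
    proof
      fix p q
      show "fst p \<in> X\<^sub>1" if "p \<in> ?X"
        using that by (simp add: mem_Times_iff)
      show "d\<^sub>1 (fst p) (fst q) \<le> ?d p q"
        using P.component_le_prod_metric(1)[where ?x1.0 = "fst p" and ?x2.0 = "fst q"
            and ?y1.0 = "snd p" and ?y2.0 = "snd q"] by simp
      show "d\<^sub>1 (fst (c (s * ?d p q))) (fst (c (t * ?d p q))) = \<bar>s - t\<bar> * d\<^sub>1 (fst p) (fst q)"
        if "P.Prod_metric.geodesic p q c" "s \<in> {0..1}" "t \<in> {0..1}" for c s t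
        using that by (rule P.product_geodesic_components)
      fix g assume g: "g \<in> carrier G"
      show "?\<phi> g (x\<^sub>1, x\<^sub>2) \<in> ?X" "fst (?\<phi> g (x\<^sub>1, x\<^sub>2)) = \<phi>\<^sub>1 g x\<^sub>1"
        using orb[OF g] by (simp_all add: act)
      show "\<kappa> * ?d (x\<^sub>1, x\<^sub>2) (?\<phi> g (x\<^sub>1, x\<^sub>2)) - C \<le> d\<^sub>1 x\<^sub>1 (\<phi>\<^sub>1 g x\<^sub>1)"
        by (rule exp[OF g])
    qed (use assms(8,11) \<kappa> in simp_all)
    show ?thesis
      by (rule exI, rule limset_map_boundary_map)
  qed
  have map2: "\<exists>f. limset_map G ?X ?d ?\<phi> (x\<^sub>1, x\<^sub>2) X\<^sub>2 d\<^sub>2 \<phi>\<^sub>2 x\<^sub>2 f"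
  proof -
    \<comment> \<open>The roles of the two embeddings are exchanged, so that displacement in the
      second factor is bounded below.\<close>
    obtain \<kappa> C where \<kappa>: "0 < \<kappa>" and C: "\<And>g. g \<in> carrier G \<Longrightarrow>
        \<kappa> * (d\<^sub>2 x\<^sub>2 (\<phi>\<^sub>2 g x\<^sub>2) + d\<^sub>1 x\<^sub>1 (\<phi>\<^sub>1 g x\<^sub>1)) - C \<le> d\<^sub>2 x\<^sub>2 (\<phi>\<^sub>2 g x\<^sub>2)"
      by (rule quasi_isometric_embeddings_comparable[OF qie(2,1) G.one_closed, unfolded one]) blast
    have exp: "\<kappa> * ?d (x\<^sub>1, x\<^sub>2) (?\<phi> g (x\<^sub>1, x\<^sub>2)) - C \<le> d\<^sub>2 x\<^sub>2 (\<phi>\<^sub>2 g x\<^sub>2)" if "g \<in> carrier G" for g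
      using C[OF that] mult_left_mono[OF le[OF that], of \<kappa>] \<kappa>
      unfolding add.commute[of "d\<^sub>2 x\<^sub>2 (\<phi>\<^sub>2 g x\<^sub>2)"] by linarith
    interpret equivariant_projection ?X ?d X\<^sub>2 d\<^sub>2 G ?\<phi> \<phi>\<^sub>2 snd "(x\<^sub>1, x\<^sub>2)" x\<^sub>2 \<kappa> C
    proof
      fix p q
      show "snd p \<in> X\<^sub>2" if "p \<in> ?X"
        using that by (simp add: mem_Times_iff)
      show "d\<^sub>2 (snd p) (snd q) \<le> ?d p q"
        using P.component_le_prod_metric(2)[where ?x1.0 = "fst p" and ?x2.0 = "fst q"
            and ?y1.0 = "snd p" and ?y2.0 = "snd q"] by simp
      show "d\<^sub>2 (snd (c (s * ?d p q))) (snd (c (t * ?d p q))) = \<bar>s - t\<bar> * d\<^sub>2 (snd p) (snd q)"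
        if "P.Prod_metric.geodesic p q c" "s \<in> {0..1}" "t \<in> {0..1}" for c s t
        using that by (rule P.product_geodesic_components)
      fix g assume g: "g \<in> carrier G"
      show "?\<phi> g (x\<^sub>1, x\<^sub>2) \<in> ?X" "snd (?\<phi> g (x\<^sub>1, x\<^sub>2)) = \<phi>\<^sub>2 g x\<^sub>2"
        using orb[OF g] by (simp_all add: act)
      show "\<kappa> * ?d (x\<^sub>1, x\<^sub>2) (?\<phi> g (x\<^sub>1, x\<^sub>2)) - C \<le> d\<^sub>2 x\<^sub>2 (\<phi>\<^sub>2 g x\<^sub>2)"
        by (rule exp[OF g])
    qed (use assms(8,11) \<kappa> in simp_all)
    show ?thesis
      by (rule exI, rule limset_map_boundary_map)
  qed
  from map1 map2 obtain f\<^sub>1 f\<^sub>2 where maps: "limset_map G ?X ?d ?\<phi> (x\<^sub>1, x\<^sub>2) X\<^sub>1 d\<^sub>1 \<phi>\<^sub>1 x\<^sub>1 f\<^sub>1"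
    "limset_map G ?X ?d ?\<phi> (x\<^sub>1, x\<^sub>2) X\<^sub>2 d\<^sub>2 \<phi>\<^sub>2 x\<^sub>2 f\<^sub>2"
    by (elim exE)
  show ?thesis
  proof (intro exI conjI impI ballI)
    show "proper_CAT0_space ?X ?d"
      using assms(6,9) by (rule product_proper_CAT0)
    show "isometric_action G ?X ?d ?\<phi>"
      using assms(7,10) by (rule product_isometric_action)
    show "(x\<^sub>1, x\<^sub>2) \<in> ?X"
      using assms(8,11) by simp
    show "Metric_space.semi_simple ?X ?d (?\<phi> g)"
      if "(\<forall>g\<in>carrier G. Metric_space.semi_simple X\<^sub>1 d\<^sub>1 (\<phi>\<^sub>1 g)) \<and>
          (\<forall>g\<in>carrier G. Metric_space.semi_simple X\<^sub>2 d\<^sub>2 (\<phi>\<^sub>2 g))" "g \<in> carrier G" for g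
      using that by (intro product_semi_simple[OF assms(7,10)]) auto
  qed (fact qie_X maps)+
qed

end
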